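(* Let $\{\zeta_i\}_{i\ge 1}$ be a sequence of random variables such that for every $m\ge 1$ the vector $\boldsymbol{\zeta}=(\zeta_1,\ldots,\zeta_m)^\top$ satisfies $\boldsymbol{\zeta}\sim\mathsf{N}_m(\boldsymbol{\mu},\boldsymbol{\Sigma})$ with correlation matrix $\mathbf{R}$ (all three depending on $m$), and fix $t\in(0,1)$. If $$m^{-2}\|\mathbf{R}\|_1=O(m^{-\delta})\quad\text{for some }\delta>0,$$ then, as $m\to\infty$, $$m^{-1}\left|R_m(t)-\mathbb{E}[R_m(t)]\right|\to 0\ \text{ a.s.}\qquad\text{and}\qquad m^{-1}\left|V_m(t)-\mathbb{E}[V_m(t)]\right|\to 0\ \text{ a.s.}$$ If further $\liminf_{m\to\infty}\pi_{0,m}>0$, then $\left|\mathrm{FDP}_m(t)-\mathbb{E}[\mathrm{FDP}_m(t)]\right|\to 0$ a.s. as $m\to\infty$.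
   Context: All random variables live on one probability space $(\Omega,\mathcal{F},\mathbb{P})$. $\mathsf{N}_m(\mathbf{a},\mathbf{C})$ is the $m$-dimensional Normal distribution with mean $\mathbf{a}$ and covariance matrix $\mathbf{C}$ (possibly singular); $\Phi$ is the CDF of $\mathsf{N}_1(0,1)$. For a matrix $\mathbf{A}$, $\|\mathbf{A}\|_1=\sum_{i,j}|\mathbf{A}(i,j)|$ (entrywise norm). The variances $\tilde\sigma_{ii}$ of $\zeta_i$ are all nonzero. The family $\{\zeta_i\}$ is a single sequence (not a triangular array), so the mean $\mu_i$ and variance $\tilde\sigma_{ii}$ of $\zeta_i$ do not depend on $m$. For each $i$ one tests $H_{i0}:\mu_i=0$ versus $H_{i1}:\mu_i\ne 0$. The p-values are either all one-sided, $p_i=1-\Phi(\tilde\sigma_{ii}^{-1/2}\zeta_i)$, or all two-sided, $p_i=2\Phi(-\tilde\sigma_{ii}^{-1/2}|\zeta_i|)$; the result is asserted for both types. $H_{i0}$ is rejected iff $p_i\le t$. $Q_{0,m}=\{1\le i\le m:\mu_i=0\}$, $m_0=|Q_{0,m}|$, $\pi_{0,m}=m_0/m$. $R_m(t)=\sum_{i=1}^m 1_{\{p_i\le t\}}$, $V_m(t)=\sum_{i\in Q_{0,m}}1_{\{p_i\le t\}}$, $\mathrm{FDP}_m(t)=V_m(t)/(R_m(t)\vee 1)$ with $a\vee b=\max\{a,b\}$. *)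

theory Defs
  imports "HOL-Probability.Probability" "HOL-Library.Landau_Symbols"
begin

text \<open>The one-dimensional normal law with mean \<open>a\<close> and standard deviation \<open>s \<ge> 0\<close>; for
  \<open>s = 0\<close> it is the point mass at \<open>a\<close>, whereas \<^const>\<open>normal_density\<close> would give the zero measure.\<close>

definition normal_law :: "real \<Rightarrow> real \<Rightarrow> real measure" where
  "normal_law a s = (if s = 0 then return borel a else density lborel (normal_density a s))"

text \<open>The random vector \<open>(X i)\<close>, \<open>i \<in> I\<close>, is normal with mean \<open>a\<close> and a possibly singular
  covariance matrix \<open>C\<close>: every linear combination is normal, possibly degenerate. All
  second moments then exist, so the integrals below are genuine, and \<open>C\<close> is symmetric and
  positive semidefinite on \<open>I\<close>. Entries of \<open>a\<close> and \<open>C\<close> outside \<open>I\<close> are irrelevant.\<close>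

definition mv_normal ::
  "'w measure \<Rightarrow> nat set \<Rightarrow> (nat \<Rightarrow> 'w \<Rightarrow> real) \<Rightarrow> (nat \<Rightarrow> real) \<Rightarrow> (nat \<Rightarrow> nat \<Rightarrow> real) \<Rightarrow> bool" where
  "mv_normal M I X a C \<longleftrightarrow>
     (\<forall>i\<in>I. X i \<in> borel_measurable M) \<and>
     (\<forall>u. \<exists>b s. s \<ge> 0 \<and> distr M borel (\<lambda>\<omega>. \<Sum>i\<in>I. u i * X i \<omega>) = normal_law b s) \<and>
     (\<forall>i\<in>I. (\<integral>\<omega>. X i \<omega> \<partial>M) = a i) \<and>
     (\<forall>i\<in>I. \<forall>j\<in>I. (\<integral>\<omega>. (X i \<omega> - a i) * (X j \<omega> - a j) \<partial>M) = C i j)"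

definition correlation_matrix :: "(nat \<Rightarrow> nat \<Rightarrow> real) \<Rightarrow> nat \<Rightarrow> nat \<Rightarrow> real" where
  "correlation_matrix C i j = C i j / (sqrt (C i i) * sqrt (C j j))"

definition entrywise_norm1 :: "nat \<Rightarrow> (nat \<Rightarrow> nat \<Rightarrow> real) \<Rightarrow> real" where
  "entrywise_norm1 m A = (\<Sum>i=1..m. \<Sum>j=1..m. \<bar>A i j\<bar>)"

definition std_normal_cdf :: "real \<Rightarrow> real" where
  "std_normal_cdf = cdf std_normal_distribution"

datatype test_type = One_Sided | Two_Sided

text \<open>Here \<open>x\<close> is the observed statistic and \<open>v\<close> its variance.\<close>

fun p_value :: "test_type \<Rightarrow> real \<Rightarrow> real \<Rightarrow> real" where
  "p_value One_Sided v x = 1 - std_normal_cdf (x / sqrt v)"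
| "p_value Two_Sided v x = 2 * std_normal_cdf (- (\<bar>x\<bar> / sqrt v))"

definition true_nulls :: "(nat \<Rightarrow> real) \<Rightarrow> nat \<Rightarrow> nat set" where
  "true_nulls \<mu> m = {i \<in> {1..m}. \<mu> i = 0}"

definition null_proportion :: "(nat \<Rightarrow> real) \<Rightarrow> nat \<Rightarrow> real" where
  "null_proportion \<mu> m = real (card (true_nulls \<mu> m)) / real m"

text \<open>In the following, \<open>p i\<close> is the \<open>i\<close>-th p-value as a random variable.\<close>

definition rejections :: "(nat \<Rightarrow> 'w \<Rightarrow> real) \<Rightarrow> real \<Rightarrow> nat \<Rightarrow> 'w \<Rightarrow> real" where
  "rejections p t m \<omega> = (\<Sum>i=1..m. of_bool (p i \<omega> \<le> t))"

definition false_rejections ::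
  "(nat \<Rightarrow> real) \<Rightarrow> (nat \<Rightarrow> 'w \<Rightarrow> real) \<Rightarrow> real \<Rightarrow> nat \<Rightarrow> 'w \<Rightarrow> real" where
  "false_rejections \<mu> p t m \<omega> = (\<Sum>i\<in>true_nulls \<mu> m. of_bool (p i \<omega> \<le> t))"

definition fdp :: "(nat \<Rightarrow> real) \<Rightarrow> (nat \<Rightarrow> 'w \<Rightarrow> real) \<Rightarrow> real \<Rightarrow> nat \<Rightarrow> 'w \<Rightarrow> real" where
  "fdp \<mu> p t m \<omega> = false_rejections \<mu> p t m \<omega> / max (rejections p t m \<omega>) 1"

end

theory Submission
  imports Defs
begin

text \<open>For standard normal \<open>X\<close>, \<open>Y\<close> with correlation \<open>r\<close>, Gebelein's inequality bounds the
  covariance of \<open>f X\<close> and \<open>g Y\<close> by \<open>\<bar>r\<bar>\<close> times the mean of their second moments. For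
  trigonometric sums \<open>f\<close>, \<open>g\<close> this only needs the characteristic function
  \<open>exp (-(s^2 + u^2)/2 - r*s*u)\<close>: expanding \<open>exp (-r*s*u)\<close> in powers of \<open>r\<close> separates the
  variables, each term beyond the constant one carries a factor \<open>r\<close>, and the squared coefficients of
  \<open>f\<close> add up to the second moment of \<open>f X\<close>. Bounded pointwise limits extend it to the rejection
  indicators, so the variance of \<open>R_m\<close> is at most the entrywise norm of the correlation matrix. A
  strong law for averages whose second moments decay at a power rate gives the first two claims.
  For the last one, \<open>E V_m / m\<close> stays away from 0, hence \<open>FDP_m - E V_m / E R_m\<close> tends to 0
  almost surely, and by bounded convergence also in mean.\<close>

section \<open>Gebelein's inequality for trigonometric sums\<close>

text \<open>The expectation of \<open>f X * g Y\<close> for the trigonometric sums with coefficients \<open>c\<close>, \<open>d\<close>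
  and frequencies \<open>s\<close>, \<open>u\<close>.\<close>

definition gauss_form :: "real \<Rightarrow> nat \<Rightarrow> (nat \<Rightarrow> complex) \<Rightarrow> (nat \<Rightarrow> real) \<Rightarrow> nat \<Rightarrow> (nat \<Rightarrow> complex) \<Rightarrow> (nat \<Rightarrow> real) \<Rightarrow> complex"
  where "gauss_form r N c s L d u =
    (\<Sum>k<N. \<Sum>l<L. c k * d l * of_real (exp (- ((s k)\<^sup>2 + (u l)\<^sup>2) / 2 - r * s k * u l)))"

text \<open>Up to the unimodular factor \<open>\<i> ^ n\<close>, this is the expectation of
  \<open>f X\<close> times the \<open>n\<close>-th Hermite polynomial of \<open>X\<close>. Writing
  it through the frequencies keeps Hermite polynomials out of the argument; for \<open>n = 0\<close>
  the convention \<open>0 ^ 0 = 1\<close> makes it the mean of \<open>f X\<close>.\<close>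

definition gauss_coeff :: "nat \<Rightarrow> (nat \<Rightarrow> complex) \<Rightarrow> (nat \<Rightarrow> real) \<Rightarrow> nat \<Rightarrow> complex"
  where "gauss_coeff N c s n = (\<Sum>k<N. c k * of_real (exp (- (s k)\<^sup>2 / 2) * s k ^ n))"

text \<open>A form of Mehler's expansion. Only the mixed term of the exponent couples
  \<open>k\<close> and \<open>l\<close>; its exponential series has terms that split into a factor
  in \<open>s k\<close> and a factor in \<open>u l\<close>, so each double sum factors.\<close>

lemma gauss_form_sums:
  "(\<lambda>n. of_real ((- r) ^ n / fact n) * (gauss_coeff N c s n * gauss_coeff L d u n))
     sums gauss_form r N c s L d u"
proof -
  have expand: "(\<lambda>n. c k * d l * of_real (exp (- ((s k)\<^sup>2 + (u l)\<^sup>2) / 2) * ((- r * s k * u l) ^ n /\<^sub>R fact n)))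
     sums (c k * d l * of_real (exp (- ((s k)\<^sup>2 + (u l)\<^sup>2) / 2 - r * s k * u l)))" for k l
  proof -
    have eq: "exp (- ((s k)\<^sup>2 + (u l)\<^sup>2) / 2 - r * s k * u l)
        = exp (- ((s k)\<^sup>2 + (u l)\<^sup>2) / 2) * exp (- r * s k * u l)"
      by (simp flip: exp_add)
    have "(\<lambda>n. exp (- ((s k)\<^sup>2 + (u l)\<^sup>2) / 2) * ((- r * s k * u l) ^ n /\<^sub>R fact n))
      sums exp (- ((s k)\<^sup>2 + (u l)\<^sup>2) / 2 - r * s k * u l)"
      unfolding eq by (intro sums_mult exp_converges)
    then show ?thesis by (rule sums_mult[OF sums_of_real])
  qed
  have "(\<lambda>n. \<Sum>k<N. \<Sum>l<L. c k * d l * of_real (exp (- ((s k)\<^sup>2 + (u l)\<^sup>2) / 2) * ((- r * s k * u l) ^ n /\<^sub>R fact n)))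
     sums gauss_form r N c s L d u"
    unfolding gauss_form_def by (intro sums_sum expand)
  moreover have "(\<Sum>k<N. \<Sum>l<L. c k * d l * of_real (exp (- ((s k)\<^sup>2 + (u l)\<^sup>2) / 2) * ((- r * s k * u l) ^ n /\<^sub>R fact n)))
     = of_real ((- r) ^ n / fact n) * (gauss_coeff N c s n * gauss_coeff L d u n)" for n
  proof -
    have "exp (- ((s k)\<^sup>2 + (u l)\<^sup>2) / 2) = exp (- (s k)\<^sup>2 / 2) * exp (- (u l)\<^sup>2 / 2)" for k l
      by (simp add: add_divide_distrib diff_divide_distrib flip: exp_add)
    moreover have "(- r * s k * u l) ^ n = (- r) ^ n * s k ^ n * u l ^ n" for k l
      by (simp only: power_mult_distrib)
    ultimately have eq: "exp (- ((s k)\<^sup>2 + (u l)\<^sup>2) / 2) * ((- r * s k * u l) ^ n /\<^sub>R fact n)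
      = ((- r) ^ n / fact n) * (exp (- (s k)\<^sup>2 / 2) * s k ^ n) * (exp (- (u l)\<^sup>2 / 2) * u l ^ n)" for k l
      by (simp only: real_scaleR_def divide_inverse mult_ac)
    show ?thesis
      unfolding eq gauss_coeff_def sum_product unfolding sum_distrib_left
      by (intro sum.cong refl) (simp only: of_real_mult mult_ac)
  qed
  ultimately show ?thesis by simp
qed

text \<open>The value at \<open>r = -1\<close> with conjugated coefficients is the second moment of \<open>\<bar>f X\<bar>\<close>, because
  conjugation turns the frequency \<open>u\<close> into \<open>-u\<close>.\<close>

lemma gauss_energy_sums:
  "(\<lambda>n. (cmod (gauss_coeff N c s n))\<^sup>2 / fact n) sums Re (gauss_form (-1) N c s N (cnj \<circ> c) s)"
proof -
  have mult_cnj: "Re (of_real q * (z * cnj z)) = q * (cmod z)\<^sup>2" for q z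
    by (simp add: cmod_power2 flip: power2_eq_square)
  have "gauss_coeff N (cnj \<circ> c) s n = cnj (gauss_coeff N c s n)" for n
    by (simp add: gauss_coeff_def)
  then have "Re (of_real ((- (-1)) ^ n / fact n) * (gauss_coeff N c s n * gauss_coeff N (cnj \<circ> c) s n))
     = (cmod (gauss_coeff N c s n))\<^sup>2 / fact n" for n
    using mult_cnj[of "1 / fact n" "gauss_coeff N c s n"] by simp
  with sums_Re[OF gauss_form_sums[of "-1" N c s N "cnj \<circ> c" s]] show ?thesis by simp
qed

text \<open>Subtracting the value at \<open>r = 0\<close> removes the constant term, and the others
  satisfy \<open>\<bar>r\<bar> ^ n \<le> \<bar>r\<bar>\<close>. Bounding a product by the mean of
  the squares, rather than by Cauchy-Schwarz, keeps the comparison of the two series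
  termwise.\<close>

lemma gauss_form_bound:
  assumes r: "\<bar>r\<bar> \<le> 1"
  shows "cmod (gauss_form r N c s L d u - gauss_form 0 N c s L d u)
     \<le> \<bar>r\<bar> * ((Re (gauss_form (-1) N c s N (cnj \<circ> c) s) + Re (gauss_form (-1) L d u L (cnj \<circ> d) u)) / 2)"
proof -
  let ?A = "gauss_coeff N c s" and ?B = "gauss_coeff L d u"
  \<comment> \<open>The factor \<open>(- 0) ^ n\<close> is the \<open>r = 0\<close> series itself:
    it is 1 at \<open>n = 0\<close> and vanishes afterwards, so \<open>h 0 = 0\<close> and the other
    terms are unchanged.\<close>
  define h where "h n = of_real (((- r) ^ n - (- 0) ^ n) / fact n) * (?A n * ?B n)" for n
  define e where "e n = \<bar>r\<bar> * (((cmod (?A n))\<^sup>2 / fact n + (cmod (?B n))\<^sup>2 / fact n) / 2)" for n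
  have h: "h sums (gauss_form r N c s L d u - gauss_form 0 N c s L d u)"
    using sums_diff[OF gauss_form_sums[of r N c s L d u] gauss_form_sums[of 0 N c s L d u]]
    by (simp add: h_def[abs_def] algebra_simps diff_divide_distrib)
  have e: "e sums (\<bar>r\<bar> * ((Re (gauss_form (-1) N c s N (cnj \<circ> c) s)
      + Re (gauss_form (-1) L d u L (cnj \<circ> d) u)) / 2))"
    unfolding e_def[abs_def] by (intro sums_mult sums_divide sums_add gauss_energy_sums)
  have he: "cmod (h n) \<le> e n" for n
  proof (cases "n = 0")
    case True
    then show ?thesis by (simp add: h_def e_def)
  next
    case False
    have "\<bar>r\<bar> ^ n \<le> \<bar>r\<bar>" using False r power_decreasing[of 1 n "\<bar>r\<bar>"] by simp
    moreover have "cmod (?A n) * cmod (?B n) \<le> ((cmod (?A n))\<^sup>2 + (cmod (?B n))\<^sup>2) / 2"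
      using sum_squares_bound[of "cmod (?A n)" "cmod (?B n)"] by simp
    ultimately have "\<bar>r\<bar> ^ n * (cmod (?A n) * cmod (?B n)) \<le> \<bar>r\<bar> * (((cmod (?A n))\<^sup>2 + (cmod (?B n))\<^sup>2) / 2)"
      by (intro mult_mono) auto
    moreover have hn: "cmod (h n) = \<bar>r\<bar> ^ n * (cmod (?A n) * cmod (?B n)) / fact n"
      using False by (simp add: h_def norm_mult norm_divide norm_power power_abs zero_power)
    moreover have en: "e n = \<bar>r\<bar> * (((cmod (?A n))\<^sup>2 + (cmod (?B n))\<^sup>2) / 2) / fact n"
      by (simp add: e_def flip: add_divide_distrib)
    ultimately show ?thesis unfolding hn en by (intro divide_right_mono) auto
  qed
  have se: "summable e" using e by (rule sums_summable)
  have sh: "summable (\<lambda>n. cmod (h n))"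
    by (rule summable_comparison_test[OF exI[of _ 0] se]) (simp add: he)
  have "cmod (suminf h) \<le> (\<Sum>n. cmod (h n))" using sh by (rule summable_norm)
  also have "\<dots> \<le> suminf e" using he sh se by (rule suminf_le)
  finally show ?thesis unfolding sums_unique[OF h, symmetric] sums_unique[OF e, symmetric] .
qed

text \<open>The inductive form makes closure under products, and hence under polynomials in a sine,
  a matter of rule induction. The indexed sum that \<open>gauss_form\<close> works with is recovered
  in \<open>trig_poly_sum_form\<close>.\<close>

inductive trig_poly :: "(real \<Rightarrow> complex) \<Rightarrow> bool" where
  wave: "trig_poly (\<lambda>x. c * cis (s * x))"
| add: "trig_poly f \<Longrightarrow> trig_poly g \<Longrightarrow> trig_poly (\<lambda>x. f x + g x)"

lemma trig_poly_sum_form: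
  assumes "trig_poly f"
  obtains N :: nat and c s where "f = (\<lambda>x. \<Sum>k<N. c k * cis (s k * x))"
proof -
  have "\<exists>xs. f = (\<lambda>x. \<Sum>(c, s)\<leftarrow>xs. c * cis (s * x))"
    using assms
  proof induction
    case (wave c s)
    show ?case by (rule exI[of _ "[(c, s)]"]) simp
  next
    case (add f g)
    then obtain xs ys where "f = (\<lambda>x. \<Sum>(c, s)\<leftarrow>xs. c * cis (s * x))"
      "g = (\<lambda>x. \<Sum>(c, s)\<leftarrow>ys. c * cis (s * x))" by blast
    then show ?case by (intro exI[of _ "xs @ ys"]) simp
  qed
  then obtain xs where xs: "f = (\<lambda>x. \<Sum>(c, s)\<leftarrow>xs. c * cis (s * x))" by blast
  have "f = (\<lambda>x. \<Sum>k<length xs. fst (xs ! k) * cis (snd (xs ! k) * x))"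
    by (simp add: xs sum_list_sum_nth case_prod_unfold atLeast0LessThan)
  then show ?thesis by (rule that[where c = "\<lambda>k. fst (xs ! k)" and s = "\<lambda>k. snd (xs ! k)"])
qed

lemma trig_poly_wave_mult:
  assumes "trig_poly f" shows "trig_poly (\<lambda>x. c * cis (s * x) * f x)"
  using assms
proof induction
  case (wave d u)
  have "(\<lambda>x. c * cis (s * x) * (d * cis (u * x))) = (\<lambda>x. (c * d) * cis ((s + u) * x))"
    by (simp add: cis_mult algebra_simps flip: cis_mult)
  then show ?case by (simp only: trig_poly.wave)
next
  case (add f g)
  then show ?case by (simp add: distrib_left trig_poly.add)
qed

lemma trig_poly_mult:
  assumes "trig_poly f" "trig_poly g" shows "trig_poly (\<lambda>x. f x * g x)"
  using assms(1)
proof induction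
  case (wave c s)
  show ?case using assms(2) by (rule trig_poly_wave_mult)
next
  case (add f1 f2)
  then show ?case by (simp add: distrib_right trig_poly.add)
qed

lemma trig_poly_const: "trig_poly (\<lambda>x. c)"
  using trig_poly.wave[of c 0] by simp

lemma trig_poly_sin: "trig_poly (\<lambda>x. of_real (sin (s * x)))"
proof -
  have "(\<lambda>x. complex_of_real (sin (s * x)))
    = (\<lambda>x. (- \<i> / 2) * cis (s * x) + (\<i> / 2) * cis ((- s) * x))"
    by (auto simp: complex_eq_iff)
  then show ?thesis by (simp only: trig_poly.intros)
qed

lemma trig_poly_polynomial_sin:
  assumes "real_polynomial_function q"
  shows "trig_poly (\<lambda>x. of_real (q (sin (s * x))))"
  using assms
proof induction
  case (linear f)
  then obtain a where "f = (\<lambda>x. x * a)" by (auto simp: real_bounded_linear)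
  then show ?case
    using trig_poly_mult[OF trig_poly_sin trig_poly_const] by simp
next
  case (const c)
  show ?case by (rule trig_poly_const)
next
  case (add f g)
  then show ?case by (simp add: trig_poly.add)
next
  case (mult f g)
  then show ?case by (simp add: trig_poly_mult)
qed

text \<open>Since sine is injective on \<open>{-pi/2..pi/2}\<close>, a polynomial approximating \<open>f (n * arcsin y)\<close>
  gives a function of \<open>sin (x / n)\<close> close to \<open>f\<close> on an interval growing with \<open>n\<close>.\<close>

lemma continuous_bounded_trig_approx:
  fixes f :: "real \<Rightarrow> real"
  assumes f: "continuous_on UNIV f" and B: "\<And>x. \<bar>f x\<bar> \<le> B"
  obtains g where "\<And>n. trig_poly (\<lambda>x. of_real (g n x))" "\<And>n x. \<bar>g n x\<bar> \<le> B + 1"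
    "\<And>x. (\<lambda>n. g n x) \<longlonglongrightarrow> f x" "\<And>n. continuous_on UNIV (g n)"
proof -
  have "\<exists>q. real_polynomial_function q \<and>
     (\<forall>y\<in>{-1..1}. \<bar>f (Suc n * arcsin y) - q y\<bar> < 1 / Suc n)" for n
  proof -
    have "continuous_on {-1..1} (\<lambda>y. f (Suc n * arcsin y))"
      by (intro continuous_on_compose2[OF f] continuous_intros) auto
    from Stone_Weierstrass_real_polynomial_function[OF compact_Icc this, of "1 / Suc n"]
    obtain q where "real_polynomial_function q" "\<And>y. y \<in> {-1..1} \<Longrightarrow> \<bar>f (Suc n * arcsin y) - q y\<bar> < 1 / Suc n"
      by auto
    then show ?thesis by blast
  qed
  then obtain q where q: "\<And>n. real_polynomial_function (q n)"
    and qf: "\<And>n y. y \<in> {-1..1} \<Longrightarrow> \<bar>f (Suc n * arcsin y) - q n y\<bar> < 1 / Suc n"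
    by metis
  define g where "g n x = q n (sin (inverse (Suc n) * x))" for n x
  show ?thesis
  proof
    show "trig_poly (\<lambda>x. of_real (g n x))" for n
      unfolding g_def using q by (rule trig_poly_polynomial_sin)
    show "continuous_on UNIV (g n)" for n
    proof -
      have "continuous_on UNIV (q n)"
        using q[of n] by (intro continuous_on_polymonial_function) (simp flip: real_polynomial_function_eq)
      then show ?thesis
        unfolding g_def by (rule continuous_on_compose2) (auto intro!: continuous_intros)
    qed
    \<comment> \<open>The bound is uniform in \<open>x\<close>, also far out where
      \<open>g n\<close> no longer resembles \<open>f\<close>: there it is close to the value of
      \<open>f\<close> at another point, again at most \<open>B\<close> in modulus.\<close>
    show "\<bar>g n x\<bar> \<le> B + 1" for n x
    proof -
      have "\<bar>f (Suc n * arcsin (sin (inverse (Suc n) * x))) - g n x\<bar> < 1 / Suc n"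
        unfolding g_def by (rule qf) auto
      moreover have "1 / Suc n \<le> (1::real)" by simp
      moreover have "\<bar>f (Suc n * arcsin (sin (inverse (Suc n) * x)))\<bar> \<le> B" by (rule B)
      ultimately show ?thesis by linarith
    qed
    show "(\<lambda>n. g n x) \<longlonglongrightarrow> f x" for x
    proof -
      \<comment> \<open>From \<open>n = K\<close> on, \<open>x / Suc n\<close> has modulus at most
        1, hence lies within half of \<open>pi\<close>, where \<open>arcsin\<close> undoes the
        sine.\<close>
      obtain K :: nat where K: "\<bar>x\<bar> \<le> K" using real_arch_simple by blast
      have close: "\<bar>g n x - f x\<bar> \<le> 1 / Suc n" if "n \<ge> K" for n
      proof -
        have "\<bar>x\<bar> \<le> Suc n" using K that by linarith
        then have "\<bar>inverse (Suc n) * x\<bar> \<le> 1"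
          by (simp add: abs_mult inverse_eq_divide pos_divide_le_eq)
        then have "- (pi / 2) \<le> inverse (Suc n) * x" "inverse (Suc n) * x \<le> pi / 2"
          using pi_gt3 by linarith+
        then have "arcsin (sin (inverse (Suc n) * x)) = inverse (Suc n) * x"
          by (simp add: arcsin_sin)
        then have "Suc n * arcsin (sin (inverse (Suc n) * x)) = x"
          by (simp add: field_simps)
        then show ?thesis
          using qf[of "sin (inverse (Suc n) * x)" n] by (simp add: g_def abs_minus_commute)
      qed
      have "(\<lambda>n. g n x - f x) \<longlonglongrightarrow> 0"
        by (rule Lim_null_comparison[OF _ LIMSEQ_Suc[OF lim_inverse_n']])
          (use close in \<open>auto simp: eventually_sequentially\<close>)
      then show ?thesis by (simp add: LIM_zero_iff)
    qed
  qed
qed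

section \<open>Characteristic functions of normal vectors\<close>

lemma borel_measurable_cis [measurable]: "cis \<in> borel_measurable borel"
  by (intro borel_measurable_continuous_onI continuous_intros)

text \<open>Deviation 0 means that \<open>W\<close> is almost surely constant; otherwise
  standardizing reduces everything to the standard normal law. Integrability is recorded separately,
  since the value of a Bochner integral does not imply it.\<close>

lemma (in prob_space) normal_law_moments:
  assumes W: "W \<in> borel_measurable M" and s: "0 \<le> s"
    and D: "distr M borel W = normal_law b s"
  shows "expectation W = b" "expectation (\<lambda>x. (W x - b)\<^sup>2) = s\<^sup>2"
    "expectation (\<lambda>x. cis (W x)) = cis b * of_real (exp (- s\<^sup>2 / 2))"
    "integrable M W" "integrable M (\<lambda>x. (W x - b)\<^sup>2)"
proof -
  have "expectation W = b \<and> expectation (\<lambda>x. (W x - b)\<^sup>2) = s\<^sup>2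
    \<and> expectation (\<lambda>x. cis (W x)) = cis b * of_real (exp (- s\<^sup>2 / 2))
    \<and> integrable M W \<and> integrable M (\<lambda>x. (W x - b)\<^sup>2)"
  proof (cases "s = 0")
    case True
    then have D': "distr M borel W = return borel b" using D by (simp add: normal_law_def)
    have "AE y in distr M borel W. y = b"
      unfolding D' by (simp add: AE_return)
    then have ae: "AE x in M. W x = b" using W by (simp add: AE_distr_iff)
    then have ae2: "AE x in M. (W x - b)\<^sup>2 = 0" "AE x in M. cis (W x) = cis b" by auto
    have 1: "expectation W = b" 
      using integral_cong_AE[of W M "\<lambda>_. b"] W ae by (simp add: prob_space)
    have 2: "expectation (\<lambda>x. (W x - b)\<^sup>2) = 0"
      using integral_cong_AE[of "\<lambda>x. (W x - b)\<^sup>2" M "\<lambda>_. 0"] W ae2 by simp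
    have 3: "expectation (\<lambda>x. cis (W x)) = cis b"
      using integral_cong_AE[of "\<lambda>x. cis (W x)" M "\<lambda>_. cis b"] W ae2
      by (simp add: prob_space)
    have 4: "integrable M W" using integrable_cong_AE[of W M "\<lambda>_. b"] W ae by simp
    have 5: "integrable M (\<lambda>x. (W x - b)\<^sup>2)"
      using integrable_cong_AE[of "\<lambda>x. (W x - b)\<^sup>2" M "\<lambda>_. 0"] W ae2 by simp
    show ?thesis using 1 2 3 4 5 True by simp
  next
    case False
    with s have s: "0 < s" by simp
    have dist: "distributed M lborel W (normal_density b s)"
      using D W s by (simp add: distributed_def normal_law_def cong: distr_cong)
    have 1: "expectation W = b" using normal_distributed_expectation[OF s dist] .
    have 2: "expectation (\<lambda>x. (W x - b)\<^sup>2) = s\<^sup>2"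
      using normal_distributed_variance[OF s dist] by (simp add: 1)
    have std: "distributed M lborel (\<lambda>x. (W x - b) / s) std_normal_density"
      using normal_standard_normal_convert[OF s] dist by simp
    have "distr M borel (\<lambda>x. (W x - b) / s) = std_normal_distribution"
      using distributed_distr_eq_density[OF std] by (simp cong: distr_cong)
    \<comment> \<open>The characteristic function is evaluated at the deviation \<open>s\<close>
      because \<open>s * ((W x - b) / s)\<close> is \<open>W x - b\<close>.\<close>
    then have "char std_normal_distribution s
        = (CLINT y|distr M borel (\<lambda>x. (W x - b) / s). iexp (s * y))"
      by (simp only: char_def)
    also have "\<dots> = expectation (\<lambda>x. iexp (s * ((W x - b) / s)))"
      using W by (intro integral_distr) auto
    also have "\<dots> = expectation (\<lambda>x. cis (W x - b))"
      using s by (simp add: cis_conv_exp)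
    finally have "expectation (\<lambda>x. cis (W x - b)) = of_real (exp (- s\<^sup>2 / 2))"
      using s by (simp add: char_std_normal_distribution)
    then have "cis b * expectation (\<lambda>x. cis (W x - b)) = cis b * of_real (exp (- s\<^sup>2 / 2))" by simp
    then have 3: "expectation (\<lambda>x. cis (W x)) = cis b * of_real (exp (- s\<^sup>2 / 2))"
      by (simp add: cis_mult flip: integral_mult_right_zero)
    have i: "integrable M (\<lambda>x. W x - b)"
      using distributed_integrable[OF dist, of "\<lambda>x. x - b"] integrable_normal_moment[OF s, of b 1]
      by simp
    have 4: "integrable M W"
      using Bochner_Integration.integrable_add[OF i integrable_const[of b]] by simp
    have 5: "integrable M (\<lambda>x. (W x - b)\<^sup>2)"
      using distributed_integrable[OF dist, of "\<lambda>x. (x - b)\<^sup>2"] integrable_normal_moment[OF s, of b 2]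
      by simp
    show ?thesis using 1 2 3 4 5 by simp
  qed
  then show "expectation W = b" "expectation (\<lambda>x. (W x - b)\<^sup>2) = s\<^sup>2"
    "expectation (\<lambda>x. cis (W x)) = cis b * of_real (exp (- s\<^sup>2 / 2))"
    "integrable M W" "integrable M (\<lambda>x. (W x - b)\<^sup>2)" by auto
qed

text \<open>The definition supplies some normal law for the combination; comparing first and second
  moments identifies its mean, and its variance \<open>s\<^sup>2\<close> as the quadratic form of
  \<open>C\<close>. Being a square, the form is nonnegative.\<close>

lemma (in prob_space) mv_normal_char:
  assumes N: "mv_normal M I X a C" and I: "finite I"
  shows "expectation (\<lambda>x. cis (\<Sum>i\<in>I. u i * (X i x - a i)))
    = of_real (exp (- (\<Sum>i\<in>I. \<Sum>j\<in>I. u i * u j * C i j) / 2))"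
    and "(\<Sum>i\<in>I. \<Sum>j\<in>I. u i * u j * C i j) \<ge> 0"
proof -
  have meas: "\<And>i. i \<in> I \<Longrightarrow> X i \<in> borel_measurable M"
    and mean: "\<And>i. i \<in> I \<Longrightarrow> expectation (X i) = a i"
    and cov: "\<And>i j. i \<in> I \<Longrightarrow> j \<in> I \<Longrightarrow> expectation (\<lambda>x. (X i x - a i) * (X j x - a j)) = C i j"
    and lin: "\<And>u. \<exists>b s. s \<ge> 0 \<and> distr M borel (\<lambda>\<omega>. \<Sum>i\<in>I. u i * X i \<omega>) = normal_law b s"
    using N unfolding mv_normal_def by blast+
  have int: "integrable M (X i)" "integrable M (\<lambda>x. (X i x - a i)\<^sup>2)" if "i \<in> I" for i
  proof -
    \<comment> \<open>Unit weights single out one coordinate, so each marginal is normal and square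
      integrable. This is what allows integrals and finite sums to be exchanged below.\<close>
    have eq: "(\<Sum>j\<in>I. (of_bool (j = i)) * X j \<omega>) = X i \<omega>" for \<omega>
      using I that by (simp add: of_bool_def if_distrib[of "\<lambda>c. c * _"] cong: if_cong)
    from lin[of "\<lambda>j. of_bool (j = i)"] obtain b s where
      "s \<ge> 0" "distr M borel (X i) = normal_law b s" unfolding eq by blast
    from normal_law_moments[OF meas[OF that] this] mean[OF that]
    show "integrable M (X i)" "integrable M (\<lambda>x. (X i x - a i)\<^sup>2)" by auto
  qed
  have int2: "integrable M (\<lambda>x. (X i x - a i) * (X j x - a j))" if "i \<in> I" "j \<in> I" for i j
  proof (rule Bochner_Integration.integrable_bound)
    show "integrable M (\<lambda>x. (X i x - a i)\<^sup>2 + (X j x - a j)\<^sup>2)" using int that by auto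
    show "(\<lambda>x. (X i x - a i) * (X j x - a j)) \<in> borel_measurable M" using meas that by auto
    show "AE x in M. norm ((X i x - a i) * (X j x - a j)) \<le> norm ((X i x - a i)\<^sup>2 + (X j x - a j)\<^sup>2)"
    proof (rule AE_I2)
      fix x
      have "2 * \<bar>X i x - a i\<bar> * \<bar>X j x - a j\<bar> \<le> (X i x - a i)\<^sup>2 + (X j x - a j)\<^sup>2"
        using sum_squares_bound[of "\<bar>X i x - a i\<bar>" "\<bar>X j x - a j\<bar>"] by simp
      moreover have "0 \<le> \<bar>X i x - a i\<bar> * \<bar>X j x - a j\<bar>" by simp
      ultimately show "norm ((X i x - a i) * (X j x - a j)) \<le> norm ((X i x - a i)\<^sup>2 + (X j x - a j)\<^sup>2)"
        unfolding real_norm_def abs_mult by linarith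
    qed
  qed
  define W where "W x = (\<Sum>i\<in>I. u i * X i x)" for x
  have W: "W \<in> borel_measurable M" unfolding W_def using meas by auto
  obtain b s where s: "s \<ge> 0" and D: "distr M borel W = normal_law b s"
    using lin[of u] unfolding W_def by blast
  note mom = normal_law_moments[OF W s D]
  have b: "b = (\<Sum>i\<in>I. u i * a i)"
    using mom(1) mean int by (simp add: W_def[abs_def] Bochner_Integration.integral_sum)
  have Wb: "W x - b = (\<Sum>i\<in>I. u i * (X i x - a i))" for x
    by (simp add: W_def b sum_subtractf algebra_simps)
  have "s\<^sup>2 = expectation (\<lambda>x. \<Sum>i\<in>I. \<Sum>j\<in>I. u i * u j * ((X i x - a i) * (X j x - a j)))"
    using mom(2) unfolding Wb by (simp add: power2_eq_square sum_product mult_ac)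
  also have "\<dots> = (\<Sum>i\<in>I. \<Sum>j\<in>I. u i * u j * C i j)"
    using int2 cov by (simp add: Bochner_Integration.integral_sum)
  finally have s2: "s\<^sup>2 = (\<Sum>i\<in>I. \<Sum>j\<in>I. u i * u j * C i j)" .
  have "expectation (\<lambda>x. cis (W x - b)) = expectation (\<lambda>x. cis (- b) * cis (W x))"
    by (simp add: cis_mult)
  also have "\<dots> = cis (- b) * (cis b * of_real (exp (- s\<^sup>2 / 2)))"
    by (simp add: mom(3))
  also have "\<dots> = of_real (exp (- s\<^sup>2 / 2))"
    by (simp add: cis_mult flip: mult.assoc)
  finally show "expectation (\<lambda>x. cis (\<Sum>i\<in>I. u i * (X i x - a i)))
    = of_real (exp (- (\<Sum>i\<in>I. \<Sum>j\<in>I. u i * u j * C i j) / 2))"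
    unfolding Wb s2 .
  show "(\<Sum>i\<in>I. \<Sum>j\<in>I. u i * u j * C i j) \<ge> 0" by (simp flip: s2)
qed

text \<open>Weights on \<open>J\<close> extend by zero to weights on \<open>I\<close>.\<close>

lemma mv_normal_subset:
  assumes N: "mv_normal M I X a C" and I: "finite I" and J: "J \<subseteq> I"
  shows "mv_normal M J X a C"
proof -
  have "\<exists>b s. s \<ge> 0 \<and> distr M borel (\<lambda>\<omega>. \<Sum>i\<in>J. u i * X i \<omega>) = normal_law b s" for u
  proof -
    have "(\<Sum>i\<in>J. u i * X i \<omega>) = (\<Sum>i\<in>I. (if i \<in> J then u i else 0) * X i \<omega>)" for \<omega>
      using I J by (intro sum.mono_neutral_cong_left) auto
    moreover have "\<exists>b s. s \<ge> 0 \<and>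
      distr M borel (\<lambda>\<omega>. \<Sum>i\<in>I. (if i \<in> J then u i else 0) * X i \<omega>) = normal_law b s"
      using N unfolding mv_normal_def by (elim conjE) (erule spec)
    ultimately show ?thesis by simp
  qed
  then show ?thesis using N J unfolding mv_normal_def by blast
qed

section \<open>Gebelein's inequality for sublevel indicators\<close>

lemma (in prob_space) expectation_trig_double_sum:
  assumes X[measurable]: "X \<in> borel_measurable M" and Y[measurable]: "Y \<in> borel_measurable M"
    and e: "\<And>k l. expectation (\<lambda>x. cis (s k * X x + u l * Y x)) = e k l"
  shows "expectation (\<lambda>x. (\<Sum>k<N. c k * cis (s k * X x)) * (\<Sum>l<L. d l * cis (u l * Y x)))
    = (\<Sum>k<N. \<Sum>l<L. c k * d l * e k l)"
proof -
  have int: "integrable M (\<lambda>x. cis (s k * X x + u l * Y x))" for k l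
    by (intro integrable_const_bound[where B = 1]) auto
  have "(\<Sum>k<N. c k * cis (s k * X x)) * (\<Sum>l<L. d l * cis (u l * Y x))
    = (\<Sum>k<N. \<Sum>l<L. c k * d l * cis (s k * X x + u l * Y x))" for x
    unfolding sum_product cis_mult[symmetric] by (simp only: mult_ac)
  then show ?thesis
    using int by (simp add: Bochner_Integration.integral_sum e)
qed

text \<open>Every expectation becomes a value of \<open>gauss_form\<close>: the mixed moment at
  \<open>r\<close>, the product of the means at 0, the second moments at -1. The claim is then
  \<open>gauss_form_bound\<close>.\<close>

lemma (in prob_space) trig_poly_covariance_bound:
  fixes f g :: "real \<Rightarrow> real"
  assumes X[measurable]: "X \<in> borel_measurable M" and Y[measurable]: "Y \<in> borel_measurable M"
    and char: "\<And>s u. expectation (\<lambda>x. cis (s * X x + u * Y x))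
      = of_real (exp (- (s\<^sup>2 + u\<^sup>2) / 2 - r * s * u))"
    and r: "\<bar>r\<bar> \<le> 1"
    and f: "trig_poly (\<lambda>x. of_real (f x))" and g: "trig_poly (\<lambda>x. of_real (g x))"
  shows "\<bar>expectation (\<lambda>x. f (X x) * g (Y x)) - expectation (\<lambda>x. f (X x)) * expectation (\<lambda>x. g (Y x))\<bar>
    \<le> \<bar>r\<bar> * ((expectation (\<lambda>x. (f (X x))\<^sup>2) + expectation (\<lambda>x. (g (Y x))\<^sup>2)) / 2)"
proof -
  obtain N :: nat and c s where "(\<lambda>x. complex_of_real (f x)) = (\<lambda>x. \<Sum>k<N. c k * cis (s k * x))"
    using trig_poly_sum_form[OF f] .
  then have f_eq: "complex_of_real (f x) = (\<Sum>k<N. c k * cis (s k * x))" for x by metis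
  obtain L :: nat and d u where "(\<lambda>x. complex_of_real (g x)) = (\<lambda>x. \<Sum>l<L. d l * cis (u l * x))"
    using trig_poly_sum_form[OF g] .
  then have g_eq: "complex_of_real (g x) = (\<Sum>l<L. d l * cis (u l * x))" for x by metis
  have charX: "expectation (\<lambda>x. cis (v * X x)) = of_real (exp (- v\<^sup>2 / 2))" for v
    using char[of v 0] by simp
  have charY: "expectation (\<lambda>x. cis (v * Y x)) = of_real (exp (- v\<^sup>2 / 2))" for v
    using char[of 0 v] by simp
  have square: "expectation (\<lambda>x. (h (W x))\<^sup>2) = Re (gauss_form (-1) K b v K (cnj \<circ> b) v)"
    if W: "W \<in> borel_measurable M" and h: "\<And>x. complex_of_real (h x) = (\<Sum>k<K. b k * cis (v k * x))"
      and charW: "\<And>w. expectation (\<lambda>x. cis (w * W x)) = of_real (exp (- w\<^sup>2 / 2))"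
    for W and h :: "real \<Rightarrow> real" and K :: nat and b v
  proof -
    \<comment> \<open>A real value equals its conjugate, so one factor of the square may be written
      with conjugated coefficients and negated frequencies. The exponent then depends on
      \<open>v k - v l\<close>, which is coupling -1.\<close>
    have "complex_of_real (h x) = cnj (complex_of_real (h x))" for x by simp
    then have h': "complex_of_real (h x) = (\<Sum>k<K. (cnj \<circ> b) k * cis (- v k * x))" for x
      unfolding h by (simp flip: cis_cnj)
    have "complex_of_real (expectation (\<lambda>x. (h (W x))\<^sup>2))
      = expectation (\<lambda>x. complex_of_real (h (W x)) * complex_of_real (h (W x)))"
      by (simp add: power2_eq_square flip: integral_complex_of_real)
    also have "\<dots> = expectation (\<lambda>x. (\<Sum>k<K. b k * cis (v k * W x)) * (\<Sum>k<K. (cnj \<circ> b) k * cis (- v k * W x)))"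
      by (simp only: h[symmetric] h'[symmetric])
    also have "\<dots> = (\<Sum>k<K. \<Sum>l<K. b k * (cnj \<circ> b) l * of_real (exp (- (v k - v l)\<^sup>2 / 2)))"
      by (rule expectation_trig_double_sum[OF W W]) (simp add: charW flip: left_diff_distrib)
    also have "\<dots> = gauss_form (-1) K b v K (cnj \<circ> b) v"
    proof -
      have "- (v k - v l)\<^sup>2 / 2 = - ((v k)\<^sup>2 + (v l)\<^sup>2) / 2 - (- 1) * v k * v l" for k l
        by (simp add: power2_diff field_simps)
      then show ?thesis unfolding gauss_form_def by presburger
    qed
    finally show ?thesis by (metis Re_complex_of_real)
  qed
  have "complex_of_real (expectation (\<lambda>x. f (X x) * g (Y x)))
      = expectation (\<lambda>x. complex_of_real (f (X x)) * complex_of_real (g (Y x)))"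
    by (simp flip: integral_complex_of_real)
  also have "\<dots> = gauss_form r N c s L d u"
    unfolding f_eq g_eq gauss_form_def by (rule expectation_trig_double_sum[OF X Y char])
  finally have fg: "complex_of_real (expectation (\<lambda>x. f (X x) * g (Y x))) = gauss_form r N c s L d u" .
  have intX: "integrable M (\<lambda>x. cis (v * X x))" and intY: "integrable M (\<lambda>x. cis (v * Y x))" for v
    by (intro integrable_const_bound[where B = 1]; simp)+
  have "complex_of_real (expectation (\<lambda>x. f (X x))) = (\<Sum>k<N. c k * of_real (exp (- (s k)\<^sup>2 / 2)))"
    using intX by (simp add: f_eq charX flip: integral_complex_of_real)
  moreover have "complex_of_real (expectation (\<lambda>x. g (Y x))) = (\<Sum>l<L. d l * of_real (exp (- (u l)\<^sup>2 / 2)))"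
    using intY by (simp add: g_eq charY flip: integral_complex_of_real)
  moreover have "(c k * complex_of_real (exp (- (s k)\<^sup>2 / 2))) * (d l * of_real (exp (- (u l)\<^sup>2 / 2)))
     = c k * d l * of_real (exp (- ((s k)\<^sup>2 + (u l)\<^sup>2) / 2 - 0 * s k * u l))" for k l
  proof -
    have "exp (- ((s k)\<^sup>2 + (u l)\<^sup>2) / 2 - 0 * s k * u l) = exp (- (s k)\<^sup>2 / 2) * exp (- (u l)\<^sup>2 / 2)"
      by (simp add: add_divide_distrib diff_divide_distrib flip: exp_add)
    then show ?thesis by (simp only: of_real_mult mult_ac)
  qed
  ultimately have f_g: "complex_of_real (expectation (\<lambda>x. f (X x)) * expectation (\<lambda>x. g (Y x)))
      = gauss_form 0 N c s L d u"
    by (simp only: of_real_mult sum_product gauss_form_def)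
  have "cmod (gauss_form r N c s L d u - gauss_form 0 N c s L d u)
    = \<bar>expectation (\<lambda>x. f (X x) * g (Y x)) - expectation (\<lambda>x. f (X x)) * expectation (\<lambda>x. g (Y x))\<bar>"
    by (metis fg f_g of_real_diff norm_of_real)
  with gauss_form_bound[OF r, of N c s L d u] square[OF X f_eq charX] square[OF Y g_eq charY]
  show ?thesis by simp
qed

lemma (in prob_space) expectation_bounded_convergence:
  fixes W :: "nat \<Rightarrow> 'a \<Rightarrow> real"
  assumes "\<And>n. W n \<in> borel_measurable M" "W' \<in> borel_measurable M" "\<And>n x. \<bar>W n x\<bar> \<le> b"
    "AE x in M. (\<lambda>n. W n x) \<longlonglongrightarrow> W' x"
  shows "(\<lambda>n. expectation (W n)) \<longlonglongrightarrow> expectation W'"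
  using assms by (intro integral_dominated_convergence[where w = "\<lambda>_. b"]) auto

text \<open>Each expectation converges by bounded convergence, and a weak inequality survives the
  limit. It serves twice: from trigonometric sums to continuous functions, and from these to
  indicators.\<close>

lemma (in prob_space) covariance_bound_limit:
  fixes U V :: "nat \<Rightarrow> 'a \<Rightarrow> real"
  assumes m: "\<And>n. U n \<in> borel_measurable M" "\<And>n. V n \<in> borel_measurable M"
    and B: "\<And>n x. \<bar>U n x\<bar> \<le> B" "\<And>n x. \<bar>V n x\<bar> \<le> B"
    and lim: "\<And>x. (\<lambda>n. U n x) \<longlonglongrightarrow> U' x" "\<And>x. (\<lambda>n. V n x) \<longlonglongrightarrow> V' x"
    and bound: "\<And>n. \<bar>expectation (\<lambda>x. U n x * V n x) - expectation (U n) * expectation (V n)\<bar>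
      \<le> r * ((expectation (\<lambda>x. (U n x)\<^sup>2) + expectation (\<lambda>x. (V n x)\<^sup>2)) / 2)"
  shows "\<bar>expectation (\<lambda>x. U' x * V' x) - expectation U' * expectation V'\<bar>
      \<le> r * ((expectation (\<lambda>x. (U' x)\<^sup>2) + expectation (\<lambda>x. (V' x)\<^sup>2)) / 2)"
proof -
  have m': "U' \<in> borel_measurable M" "V' \<in> borel_measurable M"
    using borel_measurable_LIMSEQ_real[OF lim(1) m(1)] borel_measurable_LIMSEQ_real[OF lim(2) m(2)] .
  note conv = expectation_bounded_convergence
  \<comment> \<open>The bound holds at every point of the type, so any instance shows that
    \<open>B\<close> is nonnegative.\<close>
  have B0: "0 \<le> B" using B(1)[of 0 undefined] by linarith
  have BB: "\<bar>U n x * V n x\<bar> \<le> B * B" "\<bar>(U n x)\<^sup>2\<bar> \<le> B * B" "\<bar>(V n x)\<^sup>2\<bar> \<le> B * B" for n x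
  proof -
    have "\<bar>a * b\<bar> \<le> B * B" if "\<bar>a\<bar> \<le> B" "\<bar>b\<bar> \<le> B" for a b
      using that B0 unfolding abs_mult by (intro mult_mono) auto
    then show "\<bar>U n x * V n x\<bar> \<le> B * B" "\<bar>(U n x)\<^sup>2\<bar> \<le> B * B" "\<bar>(V n x)\<^sup>2\<bar> \<le> B * B"
      using B unfolding power2_eq_square by blast+
  qed
  show ?thesis
  proof (rule tendsto_le[OF _ _ _ always_eventually[OF allI[OF bound]]])
    show "(\<lambda>n. r * ((expectation (\<lambda>x. (U n x)\<^sup>2) + expectation (\<lambda>x. (V n x)\<^sup>2)) / 2))
      \<longlonglongrightarrow> r * ((expectation (\<lambda>x. (U' x)\<^sup>2) + expectation (\<lambda>x. (V' x)\<^sup>2)) / 2)"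
      by (intro tendsto_intros conv[where b = "B * B"] AE_I2 lim BB)
        (use m m' in auto)
    have "(\<lambda>n. expectation (\<lambda>x. U n x * V n x)) \<longlonglongrightarrow> expectation (\<lambda>x. U' x * V' x)"
      by (intro conv[where b = "B * B"] tendsto_intros AE_I2 lim BB) (use m m' in auto)
    moreover have "(\<lambda>n. expectation (U n)) \<longlonglongrightarrow> expectation U'"
      by (intro conv[where b = B] AE_I2 lim B m m')
    moreover have "(\<lambda>n. expectation (V n)) \<longlonglongrightarrow> expectation V'"
      by (intro conv[where b = B] AE_I2 lim B m m')
    ultimately show "(\<lambda>n. \<bar>expectation (\<lambda>x. U n x * V n x) - expectation (U n) * expectation (V n)\<bar>)
      \<longlonglongrightarrow> \<bar>expectation (\<lambda>x. U' x * V' x) - expectation U' * expectation V'\<bar>"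
      by (intro tendsto_intros)
  qed simp
qed

lemma (in prob_space) continuous_covariance_bound:
  fixes f g :: "real \<Rightarrow> real"
  assumes X[measurable]: "X \<in> borel_measurable M" and Y[measurable]: "Y \<in> borel_measurable M"
    and char: "\<And>s u. expectation (\<lambda>x. cis (s * X x + u * Y x))
      = of_real (exp (- (s\<^sup>2 + u\<^sup>2) / 2 - r * s * u))"
    and r: "\<bar>r\<bar> \<le> 1"
    and f: "continuous_on UNIV f" "\<And>x. \<bar>f x\<bar> \<le> B" and g: "continuous_on UNIV g" "\<And>x. \<bar>g x\<bar> \<le> B"
  shows "\<bar>expectation (\<lambda>x. f (X x) * g (Y x)) - expectation (\<lambda>x. f (X x)) * expectation (\<lambda>x. g (Y x))\<bar>
    \<le> \<bar>r\<bar> * ((expectation (\<lambda>x. (f (X x))\<^sup>2) + expectation (\<lambda>x. (g (Y x))\<^sup>2)) / 2)"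
proof -
  obtain F where F: "\<And>n. trig_poly (\<lambda>x. of_real (F n x))" "\<And>n x. \<bar>F n x\<bar> \<le> B + 1"
    "\<And>x. (\<lambda>n. F n x) \<longlonglongrightarrow> f x" "\<And>n. continuous_on UNIV (F n)"
    using continuous_bounded_trig_approx[OF f] by blast
  obtain G where G: "\<And>n. trig_poly (\<lambda>x. of_real (G n x))" "\<And>n x. \<bar>G n x\<bar> \<le> B + 1"
    "\<And>x. (\<lambda>n. G n x) \<longlonglongrightarrow> g x" "\<And>n. continuous_on UNIV (G n)"
    using continuous_bounded_trig_approx[OF g] by blast
  have meas: "F n \<in> borel_measurable borel" "G n \<in> borel_measurable borel" for n
    using F(4) G(4) by (simp_all add: borel_measurable_continuous_onI)
  show ?thesis
    by (rule covariance_bound_limit[where U = "\<lambda>n x. F n (X x)" and V = "\<lambda>n x. G n (Y x)" and B = "B + 1"])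
      (use trig_poly_covariance_bound[OF X Y char r F(1) G(1)] measurable_compose[OF X meas(1)]
        measurable_compose[OF Y meas(2)] in \<open>auto intro!: F G\<close>)
qed

text \<open>The ramp descends to the right of \<open>t\<close> and equals 1 at \<open>t\<close>
  itself, so the limit is the closed indicator at every point, with no exceptional null set.\<close>

lemma ramp_tendsto_indicator:
  fixes y t :: real
  shows "(\<lambda>n. max 0 (1 - real n * max 0 (y - t))) \<longlonglongrightarrow> of_bool (y \<le> t)"
proof (cases "y \<le> t")
  case True
  then show ?thesis by (simp add: max_def)
next
  case False
  then obtain K :: nat where K: "1 < real K * (y - t)"
    using ex_less_of_nat_mult[of "y - t" 1] by auto
  have "max 0 (1 - real n * max 0 (y - t)) = 0" if "n \<ge> K" for n
  proof -
    have "real K * (y - t) \<le> real n * (y - t)" using False that by (intro mult_right_mono) auto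
    moreover have "max 0 (y - t) = y - t" using False by simp
    ultimately have "1 - real n * max 0 (y - t) \<le> 0" using K by linarith
    then show ?thesis by (rule max_absorb1)
  qed
  then show ?thesis using False by (intro tendsto_eventually) (auto simp: eventually_sequentially)
qed

text \<open>Second moments of indicators are at most 1, so only \<bar>r\<bar> remains of the bound.
  Allowing arbitrary continuous \<phi> and \<psi> covers both test types and nonzero means at
  once.\<close>

lemma (in prob_space) sublevel_covariance_bound:
  fixes \<phi> \<psi> :: "real \<Rightarrow> real"
  assumes X[measurable]: "X \<in> borel_measurable M" and Y[measurable]: "Y \<in> borel_measurable M"
    and char: "\<And>s u. expectation (\<lambda>x. cis (s * X x + u * Y x))
      = of_real (exp (- (s\<^sup>2 + u\<^sup>2) / 2 - r * s * u))"
    and r: "\<bar>r\<bar> \<le> 1"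
    and c: "continuous_on UNIV \<phi>" "continuous_on UNIV \<psi>"
  shows "\<bar>expectation (\<lambda>x. of_bool (\<phi> (X x) \<le> t) * of_bool (\<psi> (Y x) \<le> t))
      - expectation (\<lambda>x. of_bool (\<phi> (X x) \<le> t)) * expectation (\<lambda>x. of_bool (\<psi> (Y x) \<le> t))\<bar> \<le> \<bar>r\<bar>"
proof -
  define R where "R n y = max 0 (1 - real n * max 0 (y - t))" for n y
  have R1: "\<bar>R n y\<bar> \<le> 1" for n y
    unfolding R_def using mult_nonneg_nonneg[of "real n" "max 0 (y - t)"] by (simp del: mult_nonneg_nonneg)
  have Rc: "continuous_on UNIV (\<lambda>x. R n (h x))" if "continuous_on UNIV h" for h :: "real \<Rightarrow> real" and n
    unfolding R_def by (intro continuous_intros that)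
  have meas: "(\<lambda>x. R n (\<phi> x)) \<in> borel_measurable borel" "(\<lambda>x. R n (\<psi> x)) \<in> borel_measurable borel" for n
    using Rc c by (simp_all add: borel_measurable_continuous_onI)
  have "\<bar>expectation (\<lambda>x. of_bool (\<phi> (X x) \<le> t) * of_bool (\<psi> (Y x) \<le> t))
      - expectation (\<lambda>x. of_bool (\<phi> (X x) \<le> t)) * expectation (\<lambda>x. of_bool (\<psi> (Y x) \<le> t))\<bar>
    \<le> \<bar>r\<bar> * ((expectation (\<lambda>x. (of_bool (\<phi> (X x) \<le> t))\<^sup>2)
      + expectation (\<lambda>x. (of_bool (\<psi> (Y x) \<le> t))\<^sup>2)) / 2)"
  proof (rule covariance_bound_limit[where U = "\<lambda>n x. R n (\<phi> (X x))" and V = "\<lambda>n x. R n (\<psi> (Y x))" and B = 1])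
    show "(\<lambda>x. R n (\<phi> (X x))) \<in> borel_measurable M" for n
      using measurable_compose[OF X meas(1)] .
    show "(\<lambda>x. R n (\<psi> (Y x))) \<in> borel_measurable M" for n
      using measurable_compose[OF Y meas(2)] .
    show "(\<lambda>n. R n (\<phi> (X x))) \<longlonglongrightarrow> of_bool (\<phi> (X x) \<le> t)" for x
      unfolding R_def by (rule ramp_tendsto_indicator)
    show "(\<lambda>n. R n (\<psi> (Y x))) \<longlonglongrightarrow> of_bool (\<psi> (Y x) \<le> t)" for x
      unfolding R_def by (rule ramp_tendsto_indicator)
  qed (fact R1 continuous_covariance_bound[OF X Y char r Rc[OF c(1)] R1 Rc[OF c(2)] R1])+
  also have "\<dots> \<le> \<bar>r\<bar> * ((1 + 1) / 2)"
  proof -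
    have "expectation (\<lambda>x. (of_bool (P x))\<^sup>2) \<le> (1::real)" for P
    proof -
      have "expectation (\<lambda>x. (of_bool (P x))\<^sup>2) \<le> expectation (\<lambda>x. 1::real)"
        by (rule Bochner_Integration.integral_mono') auto
      then show ?thesis by (simp add: prob_space)
    qed
    then show ?thesis by (intro mult_left_mono divide_right_mono add_mono) auto
  qed
  finally show ?thesis by simp
qed

section \<open>Normal statistics and their p-values\<close>

text \<open>Dividing the weights by the standard deviations turns the quadratic form of
  \<open>C\<close> into that of the correlation matrix.\<close>

lemma (in prob_space) mv_normal_pair:
  assumes N: "mv_normal M {i, j} X a C" and ij: "i \<noteq> j" and pos: "C i i > 0" "C j j > 0"
  shows "expectation (\<lambda>x. cis (s * ((X i x - a i) / sqrt (C i i)) + u * ((X j x - a j) / sqrt (C j j))))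
      = of_real (exp (- (s\<^sup>2 + u\<^sup>2) / 2 - correlation_matrix C i j * s * u))"
    and "\<bar>correlation_matrix C i j\<bar> \<le> 1"
proof -
  let ?r = "correlation_matrix C i j"
  define w where "w s u k = (if k = i then s / sqrt (C i i) else u / sqrt (C j j))" for s u and k :: nat
  have "expectation (\<lambda>x. (X k x - a k) * (X l x - a l)) = C k l" if "k \<in> {i, j}" "l \<in> {i, j}" for k l
    using N that unfolding mv_normal_def by blast
  from this[of i j] this[of j i] have sym: "C j i = C i j" by (simp add: mult.commute)
  have lin: "(\<Sum>k\<in>{i, j}. w s u k * (X k x - a k))
      = s * ((X i x - a i) / sqrt (C i i)) + u * ((X j x - a j) / sqrt (C j j))" for s u x
    using ij by (simp add: w_def)
  have quad: "(\<Sum>k\<in>{i, j}. \<Sum>l\<in>{i, j}. w s u k * w s u l * C k l) = s\<^sup>2 + u\<^sup>2 + 2 * ?r * s * u" for s u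
  proof -
    have "s / sqrt (C i i) * (s / sqrt (C i i)) * C i i = s\<^sup>2"
      "u / sqrt (C j j) * (u / sqrt (C j j)) * C j j = u\<^sup>2"
      using pos by (simp_all add: power2_eq_square)
    then show ?thesis
      using ij by (simp add: w_def sym correlation_matrix_def)
  qed
  have "- (s\<^sup>2 + u\<^sup>2 + 2 * ?r * s * u) / 2 = - (s\<^sup>2 + u\<^sup>2) / 2 - ?r * s * u" by (simp add: field_simps)
  with mv_normal_char(1)[OF N, of "w s u"]
  show "expectation (\<lambda>x. cis (s * ((X i x - a i) / sqrt (C i i)) + u * ((X j x - a j) / sqrt (C j j))))
      = of_real (exp (- (s\<^sup>2 + u\<^sup>2) / 2 - ?r * s * u))"
    unfolding lin quad by simp
  have "0 \<le> s\<^sup>2 + u\<^sup>2 + 2 * ?r * s * u" for s u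
    using mv_normal_char(2)[OF N, of "w s u"] unfolding quad by simp
  \<comment> \<open>The nonnegative quadratic form takes the values \<open>2 + 2 * ?r\<close> and
    \<open>2 - 2 * ?r\<close> at these two points.\<close>
  from this[of 1 1] this[of 1 "-1"] show "\<bar>?r\<bar> \<le> 1" by simp
qed

text \<open>This makes the rejection probability the same for all true nulls. Characteristic
  functions determine the law, by Levy's uniqueness theorem.\<close>

lemma (in prob_space) mv_normal_standardized:
  assumes N: "mv_normal M {i} X a C" and pos: "C i i > 0"
  shows "distr M borel (\<lambda>x. (X i x - a i) / sqrt (C i i)) = std_normal_distribution"
proof (rule Levy_uniqueness)
  have m[measurable]: "X i \<in> borel_measurable M" using N by (simp add: mv_normal_def)
  show "real_distribution (distr M borel (\<lambda>x. (X i x - a i) / sqrt (C i i)))"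
    by (intro real_distribution_distr) simp
  show "real_distribution std_normal_distribution" by (rule real_dist_normal_dist)
  show "char (distr M borel (\<lambda>x. (X i x - a i) / sqrt (C i i))) = char std_normal_distribution"
  proof
    fix v
    have "char (distr M borel (\<lambda>x. (X i x - a i) / sqrt (C i i))) v
      = expectation (\<lambda>x. cis (v * ((X i x - a i) / sqrt (C i i))))"
      unfolding char_def by (subst integral_distr) (auto simp: cis_conv_exp)
    also have "\<dots> = of_real (exp (- v\<^sup>2 / 2))"
    proof -
      have "v / sqrt (C i i) * (v / sqrt (C i i)) * C i i = v\<^sup>2"
        using pos by (simp add: power2_eq_square)
      with mv_normal_char(1)[OF N, of "\<lambda>_. v / sqrt (C i i)"] show ?thesis by simp
    qed
    finally show "char (distr M borel (\<lambda>x. (X i x - a i) / sqrt (C i i))) v = char std_normal_distribution v"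
      by (simp add: char_std_normal_distribution)
  qed
qed

text \<open>A law with a density has no atoms.\<close>

lemma continuous_on_std_normal_cdf: "continuous_on UNIV std_normal_cdf"
proof -
  interpret real_distribution std_normal_distribution by (rule real_dist_normal_dist)
  have "emeasure std_normal_distribution {x} = 0" for x
    by (simp add: emeasure_density nn_integral_indicator_singleton')
  then have "isCont std_normal_cdf x" for x
    unfolding std_normal_cdf_def isCont_cdf by (simp add: measure_def)
  then show ?thesis by (simp add: continuous_at_imp_continuous_on)
qed

lemma continuous_on_p_value:
  assumes "v > 0" shows "continuous_on UNIV (p_value test v)"
proof (cases test)
  case One_Sided
  have "continuous_on UNIV (\<lambda>x. 1 - std_normal_cdf (x / sqrt v))"
    using assms by (intro continuous_intros continuous_on_compose2[OF continuous_on_std_normal_cdf]) auto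
  then show ?thesis by (simp add: One_Sided)
next
  case Two_Sided
  have "continuous_on UNIV (\<lambda>x. 2 * std_normal_cdf (- (\<bar>x\<bar> / sqrt v)))"
    using assms by (intro continuous_intros continuous_on_compose2[OF continuous_on_std_normal_cdf]) auto
  then show ?thesis by (simp add: Two_Sided)
qed

lemma p_value_scale: "v > 0 \<Longrightarrow> p_value test v (sqrt v * x) = p_value test 1 x"
  by (cases test) (simp_all add: abs_mult)

text \<open>Both kinds of p-value tend to 0 at plus infinity, so the rejection region contains a
  half-line. Positivity suffices for the lower bound on the expected number of false rejections, so
  the exact law of the p-value is not computed.\<close>

lemma std_normal_p_value_pos:
  assumes t: "0 < t"
  shows "measure std_normal_distribution {x. p_value test 1 x \<le> t} > 0"
proof -
  interpret real_distribution std_normal_distribution by (rule real_dist_normal_dist)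
  have "((\<lambda>x. p_value test 1 x) \<longlongrightarrow> 0) at_top"
  proof (cases test)
    case One_Sided
    have "((\<lambda>x. 1 - std_normal_cdf x) \<longlongrightarrow> 1 - 1) at_top"
      unfolding std_normal_cdf_def by (intro tendsto_intros cdf_lim_at_top_prob)
    then show ?thesis by (simp add: One_Sided)
  next
    case Two_Sided
    have "((\<lambda>x. 2 * std_normal_cdf (- \<bar>x\<bar>)) \<longlongrightarrow> 2 * 0) at_top"
      unfolding std_normal_cdf_def
      by (intro tendsto_intros filterlim_compose[OF cdf_lim_at_bot]
          filterlim_compose[OF filterlim_uminus_at_bot_at_top] filterlim_abs_real)
    then show ?thesis by (simp add: Two_Sided)
  qed
  then have "\<forall>\<^sub>F x in at_top. p_value test 1 x < t" using t by (rule order_tendstoD)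
  then obtain y where y: "\<And>x. x \<ge> y \<Longrightarrow> p_value test 1 x < t"
    by (auto simp: eventually_at_top_linorder)
  \<comment> \<open>The density is positive everywhere, so a null interval would also be null for
    Lebesgue measure, yet this one has length 1.\<close>
  have "{y..y + 1} \<notin> null_sets std_normal_distribution"
  proof
    assume "{y..y + 1} \<in> null_sets std_normal_distribution"
    then have "AE x in lborel. x \<in> {y..y + 1} \<longrightarrow> ennreal (std_normal_density x) = 0"
      by (subst (asm) null_sets_density_iff) auto
    then have "AE x in lborel. x \<notin> {y..y + 1}"
    proof eventually_elim
      case (elim x)
      have "std_normal_density x > 0" by (simp add: normal_density_pos)
      then show ?case using elim by auto
    qed
    then have "emeasure lborel {y..y + 1} = 0"
      by (subst (asm) AE_iff_measurable[where N = "{y..y + 1}"]) auto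
    then show False by simp
  qed
  then have "measure std_normal_distribution {y..y + 1} \<noteq> 0"
    by (auto simp: null_sets_def emeasure_eq_measure)
  then have "0 < measure std_normal_distribution {y..y + 1}" 
    by (metis measure_nonneg order_le_less)
  also have "\<dots> \<le> measure std_normal_distribution {x. p_value test 1 x \<le> t}"
  proof (rule finite_measure_mono)
    show "{y..y + 1} \<subseteq> {x. p_value test 1 x \<le> t}" using y by (auto intro: less_imp_le)
    have "closed {x. p_value test 1 x \<le> t}"
      by (intro closed_Collect_le continuous_on_p_value continuous_intros) simp
    then show "{x. p_value test 1 x \<le> t} \<in> events" by simp
  qed
  finally show ?thesis .
qed

section \<open>A strong law under weak correlation\<close>

text \<open>\<open>k m\<close> is the integer part of the \<open>a\<close>-th root of
  \<open>m\<close>; it places \<open>m\<close> between consecutive \<open>a\<close>-th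
  powers.\<close>

lemma floor_root_bracket:
  assumes a: "(a::nat) \<ge> 1"
  obtains k :: "nat \<Rightarrow> nat" where "filterlim k at_top at_top"
    "\<And>m. k m ^ a \<le> m" "\<And>m. m < Suc (k m) ^ a"
proof -
  define k where "k m = nat \<lfloor>root a (real m)\<rfloor>" for m :: nat
  have le: "k m ^ a \<le> m" for m
  proof -
    have "real (k m) \<le> root a (real m)" unfolding k_def by (intro of_nat_floor real_root_ge_zero) simp
    then have "real (k m) ^ a \<le> root a (real m) ^ a" by (intro power_mono) auto
    also have "\<dots> = real m" using a by simp
    finally show ?thesis by (simp flip: of_nat_power)
  qed
  have lt: "m < Suc (k m) ^ a" for m
  proof -
    have "root a (real m) < real (Suc (k m))" unfolding k_def by linarith
    then have "root a (real m) ^ a < real (Suc (k m)) ^ a"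
      using a by (intro power_strict_mono) auto
    moreover have "root a (real m) ^ a = real m" using a by simp
    ultimately have "real m < real (Suc (k m) ^ a)" by simp
    then show ?thesis by linarith
  qed
  have "filterlim k at_top at_top"
    unfolding filterlim_at_top
  proof
    fix Z :: nat
    show "\<forall>\<^sub>F m in at_top. Z \<le> k m"
      using eventually_ge_at_top[of "Z ^ a"]
    proof eventually_elim
      case (elim m)
      have "Z ^ a < Suc (k m) ^ a" using elim lt[of m] by linarith
      then show ?case using power_less_imp_less_base[of Z a "Suc (k m)"] by simp
    qed
  qed
  then show ?thesis using le lt that by blast
qed

text \<open>Beyond the last power below \<open>m\<close> there are at most
  \<open>Suc (k m) ^ a - k m ^ a\<close> summands, each at most 1 in modulus. Relative to
  \<open>k m ^ a\<close> they contribute at most \<open>(1 + inverse (k m)) ^ a - 1\<close>, which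
  vanishes in the limit.\<close>

lemma average_tendsto_0_from_powers:
  fixes z :: "nat \<Rightarrow> real"
  assumes a: "(a::nat) \<ge> 1" and z: "\<And>i. \<bar>z i\<bar> \<le> 1"
    and sub: "(\<lambda>k. (\<Sum>i=1..k ^ a. z i) / real (k ^ a)) \<longlonglongrightarrow> 0"
  shows "(\<lambda>m. \<bar>\<Sum>i=1..m. z i\<bar> / real m) \<longlonglongrightarrow> 0"
proof -
  obtain k where k: "filterlim k at_top at_top" and kl: "\<And>m. k m ^ a \<le> m"
    and ku: "\<And>m. m < Suc (k m) ^ a" using floor_root_bracket[OF a] by blast
  define h where "h k = \<bar>(\<Sum>i=1..k ^ a. z i) / real (k ^ a)\<bar> + ((1 + inverse (real k)) ^ a - 1)" for k
  have "h \<longlonglongrightarrow> 0 + ((1 + 0) ^ a - 1)" unfolding h_def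
    by (intro tendsto_intros tendsto_rabs_zero sub tendsto_inverse_0_at_top filterlim_real_sequentially)
  then have "h \<longlonglongrightarrow> 0" by simp
  then have "(\<lambda>m. h (k m)) \<longlonglongrightarrow> 0" using k by (rule filterlim_compose)
  moreover have "\<forall>\<^sub>F m in sequentially. norm (\<bar>\<Sum>i=1..m. z i\<bar> / real m) \<le> h (k m)"
    using k[unfolded filterlim_at_top, rule_format, of 1]
  proof eventually_elim
    case (elim m)
    let ?n = "k m ^ a"
    have n: "1 \<le> ?n" "0 < k m" "0 < m" using elim kl[of m] by (auto intro: Suc_leI gr0I)
    have "(\<Sum>i=1..m. z i) = (\<Sum>i=1..?n. z i) + (\<Sum>i=Suc ?n..m. z i)"
      using kl[of m] n sum.ub_add_nat[of 1 ?n z "m - ?n"] by simp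
    also have "\<bar>\<dots>\<bar> \<le> \<bar>\<Sum>i=1..?n. z i\<bar> + \<bar>\<Sum>i=Suc ?n..m. z i\<bar>" by (rule abs_triangle_ineq)
    also have "\<bar>\<Sum>i=Suc ?n..m. z i\<bar> \<le> (\<Sum>i=Suc ?n..m. 1)"
      by (rule order_trans[OF sum_abs sum_mono]) (rule z)
    also have "\<dots> = real m - real ?n" using kl[of m] by simp
    also have "\<dots> \<le> real (Suc (k m)) ^ a - real ?n"
      using ku[of m] by (simp flip: of_nat_power del: of_nat_Suc)
    finally have *: "\<bar>\<Sum>i=1..m. z i\<bar> \<le> \<bar>\<Sum>i=1..?n. z i\<bar> + (real (Suc (k m)) ^ a - real ?n)" by simp
    have "\<bar>\<Sum>i=1..m. z i\<bar> / real m \<le> \<bar>\<Sum>i=1..m. z i\<bar> / real ?n"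
      using kl[of m] n by (intro divide_left_mono mult_pos_pos) (auto simp flip: of_nat_power simp del: of_nat_power)
    also have "\<dots> \<le> (\<bar>\<Sum>i=1..?n. z i\<bar> + (real (Suc (k m)) ^ a - real ?n)) / real ?n"
      using * by (intro divide_right_mono) auto
    also have "\<dots> = \<bar>(\<Sum>i=1..?n. z i) / real ?n\<bar> + (real (Suc (k m)) ^ a / real ?n - 1)"
      using n by (simp add: add_divide_distrib diff_divide_distrib)
    also have "real (Suc (k m)) ^ a / real ?n = (real (Suc (k m)) / real (k m)) ^ a"
      by (simp add: power_divide)
    also have "real (Suc (k m)) / real (k m) = 1 + inverse (real (k m))"
      using n by (simp add: field_simps)
    finally show ?case by (simp add: h_def)
  qed
  ultimately show ?thesis by (rule Lim_null_comparison[rotated])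
qed

text \<open>The sum of the squares has finite expectation, hence is almost surely finite, and the
  terms of a convergent series tend to 0. This takes the place of Chebyshev and
  Borel-Cantelli.\<close>

lemma (in prob_space) AE_tendsto_0_of_summable_second_moments:
  fixes Y :: "nat \<Rightarrow> 'a \<Rightarrow> real"
  assumes Y: "\<And>k. Y k \<in> borel_measurable M" "\<And>k. integrable M (\<lambda>x. (Y k x)\<^sup>2)"
    and sm: "summable (\<lambda>k. expectation (\<lambda>x. (Y k x)\<^sup>2))"
  shows "AE x in M. (\<lambda>k. Y k x) \<longlonglongrightarrow> 0"
proof -
  have "(\<integral>\<^sup>+x. (\<Sum>k. ennreal ((Y k x)\<^sup>2)) \<partial>M) = (\<Sum>k. \<integral>\<^sup>+x. ennreal ((Y k x)\<^sup>2) \<partial>M)"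
    using Y by (intro nn_integral_suminf) auto
  also have "\<dots> = (\<Sum>k. ennreal (expectation (\<lambda>x. (Y k x)\<^sup>2)))"
    using Y by (simp add: nn_integral_eq_integral)
  also have "\<dots> = ennreal (\<Sum>k. expectation (\<lambda>x. (Y k x)\<^sup>2))"
    using sm by (intro suminf_ennreal2) auto
  finally have "(\<integral>\<^sup>+x. (\<Sum>k. ennreal ((Y k x)\<^sup>2)) \<partial>M) \<noteq> \<infinity>" by simp
  then have "AE x in M. (\<Sum>k. ennreal ((Y k x)\<^sup>2)) \<noteq> \<infinity>"
    using Y by (intro nn_integral_PInf_AE) auto
  then show ?thesis
  proof eventually_elim
    case (elim x)
    then have "summable (\<lambda>k. (Y k x)\<^sup>2)" by (intro summable_suminf_not_top) auto
    then have "(\<lambda>k. (Y k x)\<^sup>2) \<longlonglongrightarrow> 0" by (rule summable_LIMSEQ_zero)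
    then have "(\<lambda>k. sqrt ((Y k x)\<^sup>2)) \<longlonglongrightarrow> sqrt 0" by (rule tendsto_real_sqrt)
    then show ?case by (simp add: tendsto_rabs_zero_iff)
  qed
qed

text \<open>Lyons' strong law in the case of a power rate: the second moments are summable along
  \<open>k ^ a\<close> once \<open>a * \<delta> \<ge> 2\<close>, and bounded summands let the average vary
  little between consecutive powers.\<close>

lemma (in prob_space) strong_law_weak_correlation:
  fixes Z :: "nat \<Rightarrow> 'a \<Rightarrow> real"
  assumes Z: "\<And>i. Z i \<in> borel_measurable M" "\<And>i x. \<bar>Z i x\<bar> \<le> 1"
    and d: "\<delta> > 0"
    and O: "(\<lambda>m. expectation (\<lambda>x. (\<Sum>i=1..m. Z i x)\<^sup>2) / (real m)\<^sup>2) \<in> O(\<lambda>m. real m powr - \<delta>)"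
  shows "AE x in M. (\<lambda>m. \<bar>\<Sum>i=1..m. Z i x\<bar> / real m) \<longlonglongrightarrow> 0"
proof -
  obtain a :: nat where a: "a \<ge> 1" "real a * \<delta> \<ge> 2"
  proof -
    \<comment> \<open>Passing from \<open>b\<close> to \<open>Suc b\<close> secures
      \<open>a \<ge> 1\<close> while keeping the product with \<delta> at least 2.\<close>
    obtain b :: nat where "2 / \<delta> \<le> real b" using real_arch_simple by blast
    then have "2 \<le> real b * \<delta>" using d by (simp add: field_simps)
    also have "\<dots> \<le> real (Suc b) * \<delta>" using d by simp
    finally show ?thesis by (intro that[of "Suc b"]) auto
  qed
  obtain C where C: "C > 0" and ev: "\<forall>\<^sub>F m in at_top.
      norm (expectation (\<lambda>x. (\<Sum>i=1..m. Z i x)\<^sup>2) / (real m)\<^sup>2) \<le> C * norm (real m powr - \<delta>)"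
    using O by (auto elim: landau_o.bigE)
  define Y where "Y k x = (\<Sum>i=1..k ^ a. Z i x) / real (k ^ a)" for k x
  have bd: "\<bar>\<Sum>i=1..n. Z i x\<bar> \<le> real n" for n :: nat and x
    by (rule order_trans[OF sum_abs]) (use sum_mono[of "{1..n}" "\<lambda>i. \<bar>Z i x\<bar>" "\<lambda>_. 1"] Z(2) in simp)
  have Ym: "Y k \<in> borel_measurable M" for k unfolding Y_def using Z by auto
  have Yb: "\<bar>Y k x\<bar> \<le> 1" for k x
    using bd[of x "k ^ a"] by (auto simp add: Y_def divide_le_eq_1 simp del: of_nat_power)
  have Yi: "integrable M (\<lambda>x. (Y k x)\<^sup>2)" for k
    using Ym Yb by (intro integrable_const_bound[where B = 1]) (auto simp: abs_square_le_1)
  have "filterlim (\<lambda>k::nat. k ^ a) at_top at_top"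
    unfolding filterlim_at_top
  proof
    fix Z :: nat
    show "\<forall>\<^sub>F k in at_top. Z \<le> k ^ a"
      using eventually_ge_at_top[of "Suc Z"]
    proof eventually_elim
      case (elim k)
      then have "k \<le> k ^ a" using a by (intro self_le_power) auto
      then show ?case using elim by linarith
    qed
  qed
  from eventually_compose_filterlim[OF ev this] eventually_ge_at_top[of 1]
  have "\<forall>\<^sub>F k in at_top. norm (expectation (\<lambda>x. (Y k x)\<^sup>2)) \<le> C * (1 / real k ^ 2)"
  proof eventually_elim
    case (elim k)
    have "expectation (\<lambda>x. (Y k x)\<^sup>2) = expectation (\<lambda>x. (\<Sum>i=1..k ^ a. Z i x)\<^sup>2) / (real (k ^ a))\<^sup>2"
      by (simp add: Y_def power_divide)
    then have "norm (expectation (\<lambda>x. (Y k x)\<^sup>2)) \<le> C * norm (real (k ^ a) powr - \<delta>)"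
      using elim by simp
    also have "norm (real (k ^ a) powr - \<delta>) = real k powr - (real a * \<delta>)"
      using elim by (simp add: powr_powr flip: powr_realpow)
    also have "\<dots> \<le> real k powr - 2" using a elim by (intro powr_mono) auto
    also have "\<dots> = 1 / real k ^ 2" using elim by (simp add: powr_minus_divide)
    finally show ?case using C by simp
  qed
  then have "summable (\<lambda>k. expectation (\<lambda>x. (Y k x)\<^sup>2))"
    by (rule summable_comparison_test_ev)
      (auto intro!: summable_mult simp: inverse_power_summable divide_inverse)
  with AE_tendsto_0_of_summable_second_moments[of Y] Ym Yi
  have "AE x in M. (\<lambda>k. Y k x) \<longlonglongrightarrow> 0" by blast
  then show ?thesis
  proof eventually_elim
    case (elim x)
    show ?case by (rule average_tendsto_0_from_powers[OF a(1) Z(2)]) (use elim in \<open>simp add: Y_def\<close>)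
  qed
qed

text \<open>The index set \<open>K\<close> lets one statement serve all rejections and the false
  ones. The second moment of the centred sum is a sum of covariances over pairs in \<open>K\<close>,
  which the entrywise norm over all pairs dominates.\<close>

lemma (in prob_space) indicator_strong_law:
  fixes A :: "nat \<Rightarrow> 'a \<Rightarrow> bool" and K :: "nat set"
  assumes A[measurable]: "\<And>i. i \<ge> 1 \<Longrightarrow> Measurable.pred M (A i)"
    and cov: "\<And>i j. i \<ge> 1 \<Longrightarrow> j \<ge> 1 \<Longrightarrow>
      \<bar>expectation (\<lambda>x. of_bool (A i x) * of_bool (A j x))
        - expectation (\<lambda>x. of_bool (A i x)) * expectation (\<lambda>x. of_bool (A j x))\<bar> \<le> \<bar>r i j\<bar>"
    and d: "\<delta> > 0" and O: "(\<lambda>m. entrywise_norm1 m r / real m ^ 2) \<in> O(\<lambda>m. real m powr - \<delta>)"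
  shows "AE x in M. (\<lambda>m. \<bar>(\<Sum>i\<in>{i\<in>{1..m}. i \<in> K}. of_bool (A i x))
    - expectation (\<lambda>x. \<Sum>i\<in>{i\<in>{1..m}. i \<in> K}. of_bool (A i x))\<bar> / real m) \<longlonglongrightarrow> 0"
proof -
  define I where "I i x = (of_bool (A i x) :: real)" for i x
  \<comment> \<open>Setting \<open>Z\<close> to zero at index 0 and off \<open>K\<close> makes it
    measurable and bounded for every index, as the strong law requires, and turns the sum over
    \<open>K\<close> into a full sum.\<close>
  define Z where "Z i x = (if i \<ge> 1 \<and> i \<in> K then I i x - expectation (I i) else 0)" for i x
  have Im: "I i \<in> borel_measurable M" if "i \<ge> 1" for i
    unfolding I_def using A[OF that] by measurable
  have Ii: "integrable M (I i)" "integrable M (\<lambda>x. I i x * I j x)" if "i \<ge> 1" "j \<ge> 1" for i j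
    using Im that by (auto intro!: integrable_const_bound[where B = 1] simp: I_def)
  have E01: "0 \<le> expectation (I i)" "expectation (I i) \<le> 1" if "i \<ge> 1" for i
  proof -
    show "0 \<le> expectation (I i)" by (simp add: I_def)
    have "expectation (I i) \<le> expectation (\<lambda>x. 1)"
      using Ii[OF that that] by (intro integral_mono) (auto simp: I_def)
    then show "expectation (I i) \<le> 1" by (simp add: prob_space)
  qed
  have Zb: "\<bar>Z i x\<bar> \<le> 1" for i x
  proof (cases "i \<ge> 1 \<and> i \<in> K")
    case True
    have "0 \<le> I i x" "I i x \<le> 1" by (simp_all add: I_def)
    then show ?thesis using E01[of i] True by (simp add: Z_def abs_le_iff)
  next
    case False
    then show ?thesis unfolding Z_def by (simp only: if_False)
  qed
  have Zm: "Z i \<in> borel_measurable M" for i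
    unfolding Z_def using Im[of i] by (cases "i \<ge> 1 \<and> i \<in> K") auto
  have Zi: "integrable M (\<lambda>x. Z i x * Z j x)" for i j
    using Zb Zm by (intro integrable_const_bound[where B = 1]) (auto simp: abs_mult intro!: mult_le_one)
  have ZZ: "expectation (\<lambda>x. Z i x * Z j x) \<le> \<bar>r i j\<bar>" if ij: "i \<ge> 1" "j \<ge> 1" for i j
  proof (cases "i \<in> K \<and> j \<in> K")
    case True
    then have "expectation (\<lambda>x. Z i x * Z j x)
      = expectation (\<lambda>x. I i x * I j x - expectation (I j) * I i x - expectation (I i) * I j x
          + expectation (I i) * expectation (I j))"
      using ij by (simp add: Z_def algebra_simps)
    also have "\<dots> = expectation (\<lambda>x. I i x * I j x) - expectation (I i) * expectation (I j)"
      using Ii[OF ij] Ii[OF ij(2,1)] by (simp add: prob_space)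
    also have "\<dots> \<le> \<bar>r i j\<bar>" using cov[OF ij] by (simp add: I_def[abs_def])
    finally show ?thesis .
  next
    case False
    then have "(\<lambda>x. Z i x * Z j x) = (\<lambda>_. 0)" by (auto simp: Z_def)
    then show ?thesis by simp
  qed
  have second: "expectation (\<lambda>x. (\<Sum>i=1..m. Z i x)\<^sup>2) \<le> entrywise_norm1 m r" for m :: nat
  proof -
    have "expectation (\<lambda>x. (\<Sum>i=1..m. Z i x)\<^sup>2) = (\<Sum>i=1..m. \<Sum>j=1..m. expectation (\<lambda>x. Z i x * Z j x))"
      using Zi by (simp add: power2_eq_square sum_product Bochner_Integration.integral_sum)
    also have "\<dots> \<le> entrywise_norm1 m r"
      unfolding entrywise_norm1_def by (intro sum_mono ZZ) auto
    finally show ?thesis .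
  qed
  have "(\<lambda>m. expectation (\<lambda>x. (\<Sum>i=1..m. Z i x)\<^sup>2) / (real m)\<^sup>2) \<in> O(\<lambda>m. entrywise_norm1 m r / real m ^ 2)"
    by (intro landau_o.bigI[of 1] always_eventually allI)
      (auto intro!: divide_right_mono order_trans[OF second[unfolded One_nat_def] abs_ge_self])
  from landau_o.big_trans[OF this O] have "AE x in M. (\<lambda>m. \<bar>\<Sum>i=1..m. Z i x\<bar> / real m) \<longlonglongrightarrow> 0"
    by (rule strong_law_weak_correlation[OF Zm Zb d])
  moreover have "(\<Sum>i=1..m. Z i x) = (\<Sum>i\<in>{i\<in>{1..m}. i \<in> K}. of_bool (A i x))
    - expectation (\<lambda>x. \<Sum>i\<in>{i\<in>{1..m}. i \<in> K}. of_bool (A i x))" for m x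
  proof -
    have "(\<Sum>i=1..m. Z i x) = (\<Sum>i\<in>{i\<in>{1..m}. i \<in> K}. I i x - expectation (I i))"
      by (rule sum.mono_neutral_cong_right) (auto simp: Z_def)
    also have "\<dots> = (\<Sum>i\<in>{i\<in>{1..m}. i \<in> K}. I i x)
      - expectation (\<lambda>x. \<Sum>i\<in>{i\<in>{1..m}. i \<in> K}. I i x)"
      using Ii by (subst Bochner_Integration.integral_sum) (auto simp: sum_subtractf)
    finally show ?thesis by (simp add: I_def)
  qed
  ultimately show ?thesis by simp
qed

section \<open>Concentration of ratios and of the false discovery proportion\<close>

text \<open>The random ratio and its mean are both compared with the deterministic ratio
  \<open>a m\<close> of expectations. The lower bound on the mean of \<open>V m\<close> keeps the
  denominators of order \<open>m\<close>.\<close>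

lemma (in prob_space) ratio_concentration:
  fixes V R :: "nat \<Rightarrow> 'a \<Rightarrow> real"
  assumes m[measurable]: "\<And>m. V m \<in> borel_measurable M" "\<And>m. R m \<in> borel_measurable M"
    and VR: "\<And>m x. 0 \<le> V m x" "\<And>m x. V m x \<le> R m x" "\<And>m x. R m x \<le> real m"
    and V: "AE x in M. (\<lambda>m. \<bar>V m x - expectation (V m)\<bar> / real m) \<longlonglongrightarrow> 0"
    and R: "AE x in M. (\<lambda>m. \<bar>R m x - expectation (R m)\<bar> / real m) \<longlonglongrightarrow> 0"
    and e: "\<eta> > 0" and ev: "\<forall>\<^sub>F m in sequentially. \<eta> * real m \<le> expectation (V m)"
  shows "AE x in M. (\<lambda>m. \<bar>V m x / max (R m x) 1 - expectation (\<lambda>x. V m x / max (R m x) 1)\<bar>) \<longlonglongrightarrow> 0"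
proof -
  define F where "F m x = V m x / max (R m x) 1" for m x
  define a where "a m = expectation (V m) / expectation (R m)" for m
  have Fm[measurable]: "F m \<in> borel_measurable M" for m unfolding F_def by measurable
  have int: "integrable M (V m)" "integrable M (R m)" for m
  proof -
    have "\<bar>V m x\<bar> \<le> real m" "\<bar>R m x\<bar> \<le> real m" for x
      using VR[of m x] by linarith+
    then show "integrable M (V m)" "integrable M (R m)"
      by (auto intro!: integrable_const_bound[where B = "real m"])
  qed
  have F01: "0 \<le> F m x" "F m x \<le> 1" for m x
    using VR(1,2)[of m x] by (auto simp: F_def divide_le_eq_1)
  have EV: "0 \<le> expectation (V m)" "expectation (V m) \<le> expectation (R m)" for m
    using VR int by (auto intro!: integral_nonneg_AE integral_mono)
  \<comment> \<open>This also holds when the mean of \<open>R m\<close> is 0, since the quotient is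
    then 0; the dominating constant below therefore works for every \<open>m\<close>.\<close>
  have a01: "0 \<le> a m" "a m \<le> 1" for m
    using EV[of m] by (auto simp: a_def divide_le_eq_1 intro: divide_nonneg_nonneg)
  have lim: "AE x in M. (\<lambda>m. F m x - a m) \<longlonglongrightarrow> 0"
    using V R
  proof eventually_elim
    case (elim x)
    have "(\<lambda>m. (\<bar>V m x - expectation (V m)\<bar> / real m + \<bar>R m x - expectation (R m)\<bar> / real m) * (2 / \<eta>))
      \<longlonglongrightarrow> (0 + 0) * (2 / \<eta>)"
      by (intro tendsto_intros elim)
    then have "(\<lambda>m. (\<bar>V m x - expectation (V m)\<bar> / real m + \<bar>R m x - expectation (R m)\<bar> / real m) * (2 / \<eta>))
      \<longlonglongrightarrow> 0" by simp
    moreover have "\<forall>\<^sub>F m in sequentially. \<bar>R m x - expectation (R m)\<bar> / real m < \<eta> / 2"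
      using elim(2) e by (intro order_tendstoD) auto
    then have "\<forall>\<^sub>F m in sequentially. norm (F m x - a m)
      \<le> (\<bar>V m x - expectation (V m)\<bar> / real m + \<bar>R m x - expectation (R m)\<bar> / real m) * (2 / \<eta>)"
      using ev eventually_ge_at_top[of "nat \<lceil>2 / \<eta>\<rceil>"] eventually_gt_at_top[of 0]
    proof eventually_elim
      case (elim m)
      let ?v = "expectation (V m)" and ?r = "expectation (R m)"
      have m0: "real m > 0" using elim by simp
      \<comment> \<open>From here on half of \<open>\<eta> * real m\<close> is at least 1, so
        \<open>R m x\<close> exceeds 1 and the maximum in the denominator disappears.\<close>
      have "2 / \<eta> \<le> real m" using elim by linarith
      then have one: "1 \<le> \<eta> / 2 * real m" using e by (simp add: field_simps)
      have r: "\<eta> * real m \<le> ?r" using elim EV[of m] by linarith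
      have "\<bar>R m x - ?r\<bar> \<le> \<eta> / 2 * real m" using elim m0 by (simp add: field_simps)
      then have Rm: "\<eta> / 2 * real m \<le> R m x" using r by linarith
      then have R0: "1 \<le> R m x" "0 < R m x" using one by linarith+
      have r0: "0 < ?r" using r one by linarith
      \<comment> \<open>The identity follows from
        \<open>expectation (V m) = a m * expectation (R m)\<close>; only centred quantities remain
        in the numerator.\<close>
      have "F m x - a m = ((V m x - ?v) - a m * (R m x - ?r)) / R m x"
        using R0 r0 by (simp add: F_def a_def field_simps)
      also have "\<bar>\<dots>\<bar> = \<bar>(V m x - ?v) - a m * (R m x - ?r)\<bar> / R m x"
        using R0 by simp
      also have "\<dots> \<le> (\<bar>V m x - ?v\<bar> + \<bar>R m x - ?r\<bar>) / R m x"
      proof -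
        have "\<bar>a m * (R m x - ?r)\<bar> \<le> 1 * \<bar>R m x - ?r\<bar>"
          using a01[of m] unfolding abs_mult by (intro mult_right_mono) auto
        then show ?thesis using R0 by (intro divide_right_mono) auto
      qed
      also have "\<dots> \<le> (\<bar>V m x - ?v\<bar> + \<bar>R m x - ?r\<bar>) / (\<eta> / 2 * real m)"
        using Rm R0 e m0 by (intro divide_left_mono mult_pos_pos) auto
      also have "\<dots> = (\<bar>V m x - ?v\<bar> / real m + \<bar>R m x - ?r\<bar> / real m) * (2 / \<eta>)"
        using m0 e by (simp add: field_simps)
      finally show ?case by simp
    qed
    ultimately show ?case by (rule Lim_null_comparison[rotated])
  qed
  \<comment> \<open>Bounded convergence carries the almost sure limit over to the means, so
    \<open>a m\<close> cancels when the two limits are subtracted.\<close>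
  have "(\<lambda>m. expectation (\<lambda>x. F m x - a m)) \<longlonglongrightarrow> expectation (\<lambda>x. 0)"
  proof (rule integral_dominated_convergence[where w = "\<lambda>_. 1"])
    show "AE x in M. norm (F m x - a m) \<le> 1" for m
      using F01[of m] a01[of m] by (auto simp: abs_le_iff intro!: AE_I2) (smt (verit))+
  qed (use lim in auto)
  moreover have "expectation (\<lambda>x. F m x - a m) = expectation (F m) - a m" for m
  proof -
    have "integrable M (F m)"
      using F01 by (intro integrable_const_bound[where B = 1]) auto
    then show ?thesis by (simp add: prob_space)
  qed
  ultimately have Ea: "(\<lambda>m. expectation (F m) - a m) \<longlonglongrightarrow> 0" by simp
  have "AE x in M. (\<lambda>m. \<bar>F m x - expectation (F m)\<bar>) \<longlonglongrightarrow> 0"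
    using lim
  proof eventually_elim
    case (elim x)
    then have "(\<lambda>m. \<bar>(F m x - a m) - (expectation (F m) - a m)\<bar>) \<longlonglongrightarrow> \<bar>0 - 0\<bar>"
      by (intro tendsto_intros Ea)
    then show ?case by simp
  qed
  then show ?thesis by (simp add: F_def[abs_def])
qed

section \<open>Rejection counts and false discovery proportion of the normal p-values\<close>

theorem theorem1:
  fixes M :: "'w measure" and \<zeta> :: "nat \<Rightarrow> 'w \<Rightarrow> real"
    and \<mu> :: "nat \<Rightarrow> real" and \<Sigma> :: "nat \<Rightarrow> nat \<Rightarrow> real"
    and t :: real and test :: test_type and p :: "nat \<Rightarrow> 'w \<Rightarrow> real"
  defines "p \<equiv> (\<lambda>i \<omega>. p_value test (\<Sigma> i i) (\<zeta> i \<omega>))"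
  assumes "prob_space M"
    and normal: "\<And>m. m \<ge> 1 \<Longrightarrow> mv_normal M {1..m} \<zeta> \<mu> \<Sigma>"
    and var_nonzero: "\<And>i. i \<ge> 1 \<Longrightarrow> \<Sigma> i i \<noteq> 0"
    and t: "0 < t" "t < 1"
    and weak_corr: "\<exists>\<delta>>0. (\<lambda>m. entrywise_norm1 m (correlation_matrix \<Sigma>) / real m ^ 2)
                             \<in> O(\<lambda>m. real m powr - \<delta>)"
  shows "(AE \<omega> in M. (\<lambda>m. \<bar>rejections p t m \<omega> - (\<integral>\<omega>'. rejections p t m \<omega>' \<partial>M)\<bar> / real m)
            \<longlonglongrightarrow> 0) \<and>
         (AE \<omega> in M. (\<lambda>m. \<bar>false_rejections \<mu> p t m \<omega>
              - (\<integral>\<omega>'. false_rejections \<mu> p t m \<omega>' \<partial>M)\<bar> / real m) \<longlonglongrightarrow> 0) \<and>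
         (liminf (\<lambda>m. ereal (null_proportion \<mu> m)) > 0 \<longrightarrow>
           (AE \<omega> in M. (\<lambda>m. \<bar>fdp \<mu> p t m \<omega> - (\<integral>\<omega>'. fdp \<mu> p t m \<omega>' \<partial>M)\<bar>) \<longlonglongrightarrow> 0))"
proof -
  interpret prob_space M by fact
  have meas[measurable]: "\<zeta> i \<in> borel_measurable M" if "i \<ge> 1" for i
    using normal[OF that] that unfolding mv_normal_def by auto
  have pos: "\<Sigma> i i > 0" if "i \<ge> 1" for i
  proof -
    have "(\<integral>\<omega>. (\<zeta> i \<omega> - \<mu> i) * (\<zeta> i \<omega> - \<mu> i) \<partial>M) = \<Sigma> i i"
      using normal[OF that] that unfolding mv_normal_def by auto
    moreover have "0 \<le> (\<integral>\<omega>. (\<zeta> i \<omega> - \<mu> i) * (\<zeta> i \<omega> - \<mu> i) \<partial>M)"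
      by (intro integral_nonneg_AE) simp
    ultimately show ?thesis using var_nonzero[OF that] by linarith
  qed
  define X where "X i \<omega> = (\<zeta> i \<omega> - \<mu> i) / sqrt (\<Sigma> i i)" for i \<omega>
  \<comment> \<open>Absorbing mean and variance into \<open>\<phi> i\<close> presents every p-value,
    under null or alternative, as a continuous function of the standardized
    \<open>X i\<close>.\<close>
  define \<phi> where "\<phi> i x = p_value test (\<Sigma> i i) (sqrt (\<Sigma> i i) * x + \<mu> i)" for i x
  have p_eq: "p i = (\<lambda>\<omega>. \<phi> i (X i \<omega>))" if "i \<ge> 1" for i
    using pos[OF that] by (simp add: p_def \<phi>_def X_def)
  have Xm: "X i \<in> borel_measurable M" if "i \<ge> 1" for i
    using meas[OF that] unfolding X_def by measurable
  have \<phi>c: "continuous_on UNIV (\<phi> i)" if "i \<ge> 1" for i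
    unfolding \<phi>_def
    by (intro continuous_on_compose2[OF continuous_on_p_value[OF pos[OF that]]] continuous_intros) auto
  have p_meas: "p i \<in> borel_measurable M" if "i \<ge> 1" for i
    using measurable_compose[OF Xm[OF that] borel_measurable_continuous_onI[OF \<phi>c[OF that]]]
    by (simp only: p_eq[OF that])
  then have pred: "Measurable.pred M (\<lambda>\<omega>. p i \<omega> \<le> t)" if "i \<ge> 1" for i
    using that by measurable
  have cov: "\<bar>expectation (\<lambda>\<omega>. of_bool (p i \<omega> \<le> t) * of_bool (p j \<omega> \<le> t))
      - expectation (\<lambda>\<omega>. of_bool (p i \<omega> \<le> t)) * expectation (\<lambda>\<omega>. of_bool (p j \<omega> \<le> t))\<bar>
    \<le> \<bar>correlation_matrix \<Sigma> i j\<bar>" if ij: "i \<ge> 1" "j \<ge> 1" for i j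
  proof (cases "i = j")
    case True
    \<comment> \<open>On the diagonal the covariance is the variance \<open>e - e * e\<close> of an
      indicator, which lies between 0 and 1; the pair argument needs distinct indices.\<close>
    have "correlation_matrix \<Sigma> i i = 1"
      using pos[OF ij(1)] by (simp add: correlation_matrix_def)
    moreover define e where "e = expectation (\<lambda>\<omega>. of_bool (p i \<omega> \<le> t) :: real)"
    have "e \<le> expectation (\<lambda>\<omega>. 1)"
      unfolding e_def by (rule Bochner_Integration.integral_mono') auto
    then have "0 \<le> e" "e \<le> 1" by (simp_all add: e_def prob_space)
    then have "0 \<le> e * e" "e * e \<le> e" by (simp_all add: mult_left_le)
    then have "\<bar>e - e * e\<bar> \<le> 1" using \<open>e \<le> 1\<close> unfolding abs_le_iff by linarith
    ultimately show ?thesis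
      unfolding True[symmetric] of_bool_conj[symmetric] conj_absorb e_def by simp
  next
    case False
    have N: "mv_normal M {i, j} \<zeta> \<mu> \<Sigma>"
      by (rule mv_normal_subset[OF normal[of "max i j"]]) (use ij in auto)
    have char: "expectation (\<lambda>\<omega>. cis (s * X i \<omega> + u * X j \<omega>))
      = of_real (exp (- (s\<^sup>2 + u\<^sup>2) / 2 - correlation_matrix \<Sigma> i j * s * u))" for s u
      unfolding X_def by (rule mv_normal_pair(1)[where C = \<Sigma>, OF N False pos[OF ij(1)] pos[OF ij(2)]])
    show ?thesis
      unfolding p_eq[OF ij(1)] p_eq[OF ij(2)]
      by (rule sublevel_covariance_bound[OF Xm[OF ij(1)] Xm[OF ij(2)] char
            mv_normal_pair(2)[where C = \<Sigma>, OF N False pos[OF ij(1)] pos[OF ij(2)]]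
            \<phi>c[OF ij(1)] \<phi>c[OF ij(2)]])
  qed
  obtain \<delta> where \<delta>: "\<delta> > 0"
    and O: "(\<lambda>m. entrywise_norm1 m (correlation_matrix \<Sigma>) / real m ^ 2) \<in> O(\<lambda>m. real m powr - \<delta>)"
    using weak_corr by blast
  note slln = indicator_strong_law[where A = "\<lambda>i \<omega>. p i \<omega> \<le> t", OF pred cov \<delta> O]
  have R: "AE \<omega> in M. (\<lambda>m. \<bar>rejections p t m \<omega> - expectation (rejections p t m)\<bar> / real m) \<longlonglongrightarrow> 0"
    using slln[where K = UNIV]
    by (simp only: rejections_def[abs_def] UNIV_I simp_thms Collect_mem_eq)
  have V: "AE \<omega> in M. (\<lambda>m. \<bar>false_rejections \<mu> p t m \<omega> - expectation (false_rejections \<mu> p t m)\<bar> / real m)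
      \<longlonglongrightarrow> 0"
    using slln[where K = "{i. \<mu> i = 0}"] by (simp only: false_rejections_def[abs_def] true_nulls_def mem_Collect_eq)
  have F: "AE \<omega> in M. (\<lambda>m. \<bar>fdp \<mu> p t m \<omega> - expectation (fdp \<mu> p t m)\<bar>) \<longlonglongrightarrow> 0"
    if liminf: "liminf (\<lambda>m. ereal (null_proportion \<mu> m)) > 0"
  proof -
    \<comment> \<open>\<open>q\<close> is the common rejection probability of all true nulls, so the
      expected number of false rejections is exactly \<open>q\<close> times their number.\<close>
    define q where "q = measure std_normal_distribution {x. p_value test 1 x \<le> t}"
    have q: "q > 0" unfolding q_def by (rule std_normal_p_value_pos[OF t(1)])
    have null: "expectation (\<lambda>\<omega>. of_bool (p i \<omega> \<le> t)) = q" if i: "i \<ge> 1" "\<mu> i = 0" for i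
    proof -
      have N: "mv_normal M {i} \<zeta> \<mu> \<Sigma>"
        by (rule mv_normal_subset[OF normal[OF i(1)]]) (use i in auto)
      have cl: "{x. p_value test 1 x \<le> t} \<in> sets borel"
        by (intro borel_closed closed_Collect_le continuous_on_p_value continuous_intros) simp
      have "q = measure (distr M borel (X i)) {x. p_value test 1 x \<le> t}"
        using mv_normal_standardized[OF N pos[OF i(1)]] by (simp add: q_def X_def[abs_def])
      also have "\<dots> = prob {\<omega> \<in> space M. p i \<omega> \<le> t}"
        using Xm[OF i(1)] cl pos[OF i(1)] i(2)
        by (subst measure_distr)
          (auto simp: p_eq[OF i(1)] \<phi>_def p_value_scale intro!: arg_cong[where f = prob])
      also have "\<dots> = expectation (indicator {\<omega> \<in> space M. p i \<omega> \<le> t})"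
        by (simp add: Int_def conj_commute)
      also have "\<dots> = expectation (\<lambda>\<omega>. of_bool (p i \<omega> \<le> t))"
        by (intro Bochner_Integration.integral_cong) (auto simp: indicator_def)
      finally show ?thesis by simp
    qed
    have EV: "expectation (false_rejections \<mu> p t m) = q * card (true_nulls \<mu> m)" for m
    proof -
      have "integrable M (\<lambda>\<omega>. of_bool (p i \<omega> \<le> t) :: real)" if "i \<ge> 1" for i
        using pred[OF that] by (intro integrable_const_bound[where B = 1]) auto
      then have "expectation (false_rejections \<mu> p t m)
          = (\<Sum>i\<in>true_nulls \<mu> m. expectation (\<lambda>\<omega>. of_bool (p i \<omega> \<le> t)))"
        unfolding false_rejections_def
        by (intro Bochner_Integration.integral_sum) (auto simp: true_nulls_def)
      also have "\<dots> = (\<Sum>i\<in>true_nulls \<mu> m. q)"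
        by (intro sum.cong null) (auto simp: true_nulls_def)
      finally show ?thesis by (simp add: mult.commute)
    qed
    \<comment> \<open>A constant strictly between 0 and the limit inferior bounds the null
      proportion from below eventually; \<open>q * c\<close> then plays the part of \<eta> in
      \<open>ratio_concentration\<close>.\<close>
    obtain c where c: "0 < ereal c" "ereal c < liminf (\<lambda>m. ereal (null_proportion \<mu> m))"
      using ereal_dense2[OF liminf] by blast
    from less_LiminfD[OF c(2)] have "\<forall>\<^sub>F m in sequentially. q * c * real m \<le> expectation (false_rejections \<mu> p t m)"
      using eventually_gt_at_top[of 0]
    proof eventually_elim
      case (elim m)
      then have "c * real m \<le> real (card (true_nulls \<mu> m))"
        by (simp add: null_proportion_def field_simps)
      then show ?case using q by (simp add: EV mult.assoc)
    qed
    moreover have "false_rejections \<mu> p t m \<in> borel_measurable M" for m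
      unfolding false_rejections_def using pred by (intro borel_measurable_sum) (auto simp: true_nulls_def)
    moreover have "rejections p t m \<in> borel_measurable M" for m
      unfolding rejections_def using pred by (intro borel_measurable_sum) auto
    moreover have "0 \<le> false_rejections \<mu> p t m \<omega>" for m \<omega>
      unfolding false_rejections_def by (intro sum_nonneg) simp
    moreover have "false_rejections \<mu> p t m \<omega> \<le> rejections p t m \<omega>" for m \<omega>
      unfolding false_rejections_def rejections_def by (intro sum_mono2) (auto simp: true_nulls_def)
    moreover have "rejections p t m \<omega> \<le> real m" for m \<omega>
      unfolding rejections_def
      using sum_mono[of "{1..m}" "\<lambda>i. of_bool (p i \<omega> \<le> t)" "\<lambda>_. 1::real"] by simp
    ultimately show ?thesis
      using ratio_concentration[of "false_rejections \<mu> p t" "rejections p t" "q * c"] V R q c(1)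
      by (simp add: fdp_def[abs_def])
  qed
  show ?thesis using R V F by blast
qed

end
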